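(* A connected graph $G$ has exactly two distance eigenvalues (counting multiplicity) different from $-1$ and $-3$ if and only if one of the following holds (with integer parameters): (i) $G\cong(K_5\cup K_1)\vee mK_2$ for some $m\ge1$; or (ii) $G\cong K_r\vee mK_2$ for some $r\ge1$, $m\ge2$; or (iii) $G\cong m_1K_2\vee m_2K_2$ for some $m_1,m_2\ge2$.
   Context: All graphs are finite and simple. For a connected graph $G$ with vertices $v_1,\ldots,v_n$, the distance matrix is $D(G)=(d(v_i,v_j))_{n\times n}$, where $d(v_i,v_j)$ is the length of a shortest path; the distance eigenvalues of $G$ are the eigenvalues of $D(G)$. $G\vee H$ denotes the join of vertex-disjoint graphs, $\cup$ denotes disjoint union, $K_s$ is the complete graph on $s$ vertices, and $mK_s$ is the disjoint union of $m$ copies of $K_s$. *)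

theory Defs
  imports "Graph_Theory.Graph_Theory" "Jordan_Normal_Form.Char_Poly"
begin

text \<open>A finite simple graph is a \<^term>\<open>G :: 'a pair_pre_digraph\<close> satisfying the locale
  predicate \<^const>\<open>pair_graph\<close> of \<^theory>\<open>Graph_Theory.Pair_Digraph\<close> (finite, symmetric, without
  loops or parallel arcs): an edge is represented by the two opposite arcs joining its end points.\<close>

definition complete_graph :: "nat \<Rightarrow> nat pair_pre_digraph" where
  "complete_graph s = \<lparr>pverts = {..<s}, parcs = {(u, v). u < s \<and> v < s \<and> u \<noteq> v}\<rparr>"

text \<open>Disjoint unions and joins are formed on sum and product types, so the operands need not have
  disjoint vertex sets.\<close>

definition graph_union ::
    "'a pair_pre_digraph \<Rightarrow> 'b pair_pre_digraph \<Rightarrow> ('a + 'b) pair_pre_digraph" where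
  "graph_union G H =
     \<lparr>pverts = pverts G <+> pverts H,
      parcs = {(Inl u, Inl v) |u v. (u, v) \<in> parcs G} \<union> {(Inr u, Inr v) |u v. (u, v) \<in> parcs H}\<rparr>"

definition graph_join ::
    "'a pair_pre_digraph \<Rightarrow> 'b pair_pre_digraph \<Rightarrow> ('a + 'b) pair_pre_digraph" where
  "graph_join G H =
     \<lparr>pverts = pverts G <+> pverts H,
      parcs = parcs (graph_union G H)
        \<union> {(Inl u, Inr v) |u v. u \<in> pverts G \<and> v \<in> pverts H}
        \<union> {(Inr v, Inl u) |u v. u \<in> pverts G \<and> v \<in> pverts H}\<rparr>"

definition graph_copies :: "nat \<Rightarrow> 'a pair_pre_digraph \<Rightarrow> (nat \<times> 'a) pair_pre_digraph" where
  "graph_copies m G =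
     \<lparr>pverts = {..<m} \<times> pverts G,
      parcs = {((i, u), (i, v)) |i u v. i < m \<and> (u, v) \<in> parcs G}\<rparr>"

text \<open>The value of \<open>graph_dist\<close> is meaningful only if some path joins the two vertices.\<close>

definition graph_dist :: "'a pair_pre_digraph \<Rightarrow> 'a \<Rightarrow> 'a \<Rightarrow> nat" where
  "graph_dist G u v = (LEAST k. \<exists>p. pre_digraph.apath (with_proj G) u p v \<and> length p = k)"

text \<open>The list \<open>vs\<close> is the enumeration \<open>v\<^sub>1, \<dots>, v\<^sub>n\<close> of the vertices.\<close>

definition distance_matrix :: "'a pair_pre_digraph \<Rightarrow> 'a list \<Rightarrow> real mat" where
  "distance_matrix G vs =
     mat (length vs) (length vs) (\<lambda>(i, j). real (graph_dist G (vs ! i) (vs ! j)))"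

text \<open>The multiset of distance eigenvalues, each repeated according to its multiplicity as a root
  of the characteristic polynomial. No eigenvalue is lost by working over the reals, as the matrix
  is symmetric.\<close>

definition distance_eigenvalues :: "'a pair_pre_digraph \<Rightarrow> 'a list \<Rightarrow> real multiset" where
  "distance_eigenvalues G vs = proots (char_poly (distance_matrix G vs))"

lemma distance_matrix_carrier:
  "distance_matrix G vs \<in> carrier_mat (length vs) (length vs)"
  by (simp add: distance_matrix_def)

lemma set_mset_distance_eigenvalues:
  "set_mset (distance_eigenvalues G vs) = {x. eigenvalue (distance_matrix G vs) x}"
proof -
  have "char_poly (distance_matrix G vs) \<noteq> 0"
    using degree_monic_char_poly[OF distance_matrix_carrier[of G vs]] by auto
  then show ?thesis
    by (auto simp: distance_eigenvalues_def eigenvalue_root_char_poly[OF distance_matrix_carrier])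
qed

lemma pair_graph_complete_graph: "pair_graph (complete_graph s)"
proof -
  have "parcs (complete_graph s) \<subseteq> {..<s} \<times> {..<s}"
    by (auto simp: complete_graph_def)
  then have "finite (parcs (complete_graph s))"
    by (rule finite_subset) simp
  then show ?thesis
    by unfold_locales (auto simp: complete_graph_def symmetric_def sym_def)
qed

lemma complete_digraph_complete_graph: "complete_digraph s (with_proj (complete_graph s))"
  unfolding complete_digraph_pair_def by (auto simp: complete_graph_def)

lemma pair_graph_graph_union:
  assumes "pair_graph G" "pair_graph H"
  shows "pair_graph (graph_union G H)"
proof -
  interpret G: pair_graph G by fact
  interpret H: pair_graph H by fact
  have "parcs (graph_union G H) \<subseteq> (pverts G <+> pverts H) \<times> (pverts G <+> pverts H)"
    by (auto simp: graph_union_def dest: G.wellformed' H.wellformed')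
  then have "finite (parcs (graph_union G H))"
    by (rule finite_subset) (simp add: G.pair_finite_verts H.pair_finite_verts)
  then show ?thesis
    using G.pair_sym_arcs H.pair_sym_arcs
    by unfold_locales
      (auto simp: graph_union_def symmetric_def G.pair_finite_verts H.pair_finite_verts
        dest: G.wellformed' H.wellformed' G.pair_no_loops H.pair_no_loops intro!: symI elim: symE)
qed

lemma pair_graph_graph_join:
  assumes "pair_graph G" "pair_graph H"
  shows "pair_graph (graph_join G H)"
proof -
  interpret G: pair_graph G by fact
  interpret H: pair_graph H by fact
  have "parcs (graph_join G H) \<subseteq> (pverts G <+> pverts H) \<times> (pverts G <+> pverts H)"
    by (auto simp: graph_join_def graph_union_def dest: G.wellformed' H.wellformed')
  then have "finite (parcs (graph_join G H))"
    by (rule finite_subset) (simp add: G.pair_finite_verts H.pair_finite_verts)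
  then show ?thesis
    using G.pair_sym_arcs H.pair_sym_arcs
    by unfold_locales
      (auto simp: graph_join_def graph_union_def symmetric_def G.pair_finite_verts
        H.pair_finite_verts
        dest: G.wellformed' H.wellformed' G.pair_no_loops H.pair_no_loops intro!: symI elim: symE)
qed

lemma pair_graph_graph_copies:
  assumes "pair_graph G"
  shows "pair_graph (graph_copies m G)"
proof -
  interpret G: pair_graph G by fact
  have "parcs (graph_copies m G) \<subseteq> ({..<m} \<times> pverts G) \<times> ({..<m} \<times> pverts G)"
    by (auto simp: graph_copies_def dest: G.wellformed')
  then have "finite (parcs (graph_copies m G))"
    by (rule finite_subset) (simp add: G.pair_finite_verts)
  then show ?thesis
    using G.pair_sym_arcs
    by unfold_locales
      (auto simp: graph_copies_def symmetric_def G.pair_finite_verts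
        dest: G.wellformed' G.pair_no_loops intro!: symI elim: symE)
qed

end

theory Submission
  imports Defs "Jordan_Normal_Form.Schur_Decomposition"
    "HOL-Computational_Algebra.Fundamental_Theorem_Algebra"
begin

text \<open>
Let \<open>D\<close> be the distance matrix and \<open>H\<close> the complement of \<open>G\<close>. By the spectral theorem, the number of
eigenvalues other than \<open>-1\<close> and \<open>-3\<close> is the rank of \<open>M = (D + I) (D + 3 I)\<close>.

Suppose that the rank is 2. A path of length 2 between nonadjacent vertices spans a plane on which
\<open>D + I\<close> is positive definite, so both exceptional eigenvalues exceed \<open>-1\<close>. Hence \<open>D + 3 I\<close> is positive
semidefinite, \<open>D + I\<close> is positive definite on no 3-space, and \<open>M\<close> is the Gram matrix of points \<open>p\<^sub>u\<close> of
the plane. Semidefiniteness excludes isometric paths of length 3, so the diameter is 2 and \<open>D + I\<close> has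
the entries 1 (on the diagonal and at edges of \<open>G\<close>) and 2 (at edges of \<open>H\<close>). The second property
forbids five graphs on 5 vertices as induced subgraphs of \<open>H\<close>; as every edge of \<open>H\<close> has a vertex
adjacent in \<open>H\<close> to neither end, it follows that \<open>H\<close> is the disjoint union of two complete
multipartite graphs (one of which may be edgeless). For vertices in different parts, of sizes
\<open>a\<close> and \<open>b\<close>, of the same side, the squared distance of \<open>p\<^sub>u\<close> and \<open>p\<^sub>v\<close> is \<open>a + b - 4\<close>. Together with the exclusion of
\<open>K\<^bsub>2,3\<^esub>\<close> this leaves sides that are edgeless, that have all parts of size 2, or that are stars \<open>K\<^bsub>1,b\<^esub>\<close> with
\<open>b \<ge> 4\<close>. For a star, the vanishing of a \<open>3 \<times> 3\<close> Gram determinant forces \<open>b = 5\<close> and parts of size 2 on the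
other side.

Conversely, in each of the three families the rows of \<open>M\<close> are spanned by two of them.
\<close>

section \<open>Spectral decomposition of real symmetric matrices\<close>

text \<open>The Hermitian form \<open>q\<close> of \<open>A\<close> at an eigenvector equals
  \<open>c * r\<close>, where \<open>r\<close> is the squared norm of the eigenvector. Symmetry
  makes \<open>q\<close> invariant under conjugation, and \<open>r\<close> is real and
  nonzero.\<close>

lemma symmetric_eigenvalue_real:
  fixes A :: "real mat"
  assumes A: "A \<in> carrier_mat n n"
    and sym: "\<And>i j. i < n \<Longrightarrow> j < n \<Longrightarrow> A $$ (i, j) = A $$ (j, i)"
    and ev: "eigenvalue (map_mat complex_of_real A) c"
  shows "cnj c = c"
proof -
  let ?C = "map_mat complex_of_real A"
  have C: "?C \<in> carrier_mat n n" using A by simp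
  from ev obtain v where v: "v \<in> carrier_vec n" "v \<noteq> 0\<^sub>v n" and eq: "?C *\<^sub>v v = c \<cdot>\<^sub>v v"
    using C by (auto simp: eigenvalue_def eigenvector_def)
  have row: "(\<Sum>j<n. complex_of_real (A $$ (i, j)) * v $ j) = c * v $ i" if i: "i < n" for i
  proof -
    have "(?C *\<^sub>v v) $ i = (\<Sum>j<n. complex_of_real (A $$ (i, j)) * v $ j)"
      using i C v A by (auto simp: scalar_prod_def lessThan_atLeast0 intro!: sum.cong)
    moreover have "(c \<cdot>\<^sub>v v) $ i = c * v $ i" using i v by simp
    ultimately show ?thesis using eq by simp
  qed
  define q where "q = (\<Sum>i<n. \<Sum>j<n. cnj (v $ i) * complex_of_real (A $$ (i, j)) * v $ j)"
  define r where "r = (\<Sum>i<n. cnj (v $ i) * v $ i)"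
  have q: "q = c * r"
    unfolding q_def r_def sum_distrib_left
    by (rule sum.cong[OF refl])
      (use row in \<open>simp add: mult.assoc sum_distrib_left[symmetric] mult.left_commute\<close>)
  have "cnj q = (\<Sum>i<n. \<Sum>j<n. cnj (v $ j) * complex_of_real (A $$ (j, i)) * v $ i)"
    unfolding q_def cnj_sum by (intro sum.cong refl) (use sym in \<open>simp add: mult_ac\<close>)
  also have "\<dots> = q" unfolding q_def by (rule sum.swap)
  finally have "cnj q = q" .
  moreover have "cnj r = r" unfolding r_def cnj_sum by (simp add: mult.commute)
  moreover have "r \<noteq> 0"
  proof -
    have r': "r = complex_of_real (\<Sum>i<n. (cmod (v $ i))\<^sup>2)"
      unfolding r_def of_real_sum by (intro sum.cong refl) (simp add: complex_norm_square mult.commute del: of_real_power)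
    obtain i where i: "i < n" "v $ i \<noteq> 0"
      using v by (metis carrier_vecD eq_vecI index_zero_vec(1) index_zero_vec(2))
    have "0 < (\<Sum>i<n. (cmod (v $ i))\<^sup>2)"
      by (rule sum_pos2[of _ i]) (use i in auto)
    then show ?thesis unfolding r' of_real_eq_0_iff by linarith
  qed
  ultimately show ?thesis using q by simp
qed

text \<open>The characteristic polynomial has a complex root by the fundamental theorem of algebra;
  it is real by \<open>symmetric_eigenvalue_real\<close>, hence a root over the reals.\<close>

lemma symmetric_eigenvalue_exists:
  fixes A :: "real mat"
  assumes A: "A \<in> carrier_mat n n" and n: "n > 0"
    and sym: "\<And>i j. i < n \<Longrightarrow> j < n \<Longrightarrow> A $$ (i, j) = A $$ (j, i)"
  obtains e where "eigenvalue A e"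
proof -
  let ?C = "map_mat complex_of_real A"
  have C: "?C \<in> carrier_mat n n" using A by simp
  have deg: "degree (char_poly ?C) = n" using degree_monic_char_poly[OF C] by simp
  then have "\<not> constant (poly (char_poly ?C))"
    using n constant_degree[of "char_poly ?C"] by simp
  then obtain c where c: "poly (char_poly ?C) c = 0"
    using fundamental_theorem_of_algebra by blast
  then have "eigenvalue ?C c" using eigenvalue_root_char_poly[OF C] by simp
  then have "cnj c = c" using symmetric_eigenvalue_real[OF A sym] by blast
  then have "c = complex_of_real (Re c)"
    by (simp add: complex_eq_iff)
  moreover have "char_poly ?C = map_poly complex_of_real (char_poly A)"
    by (rule of_real_hom.char_poly_hom[OF A])
  ultimately have "complex_of_real (poly (char_poly A) (Re c)) = 0"
    using c by (metis of_real_hom.poly_map_poly)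
  then have "eigenvalue A (Re c)" using eigenvalue_root_char_poly[OF A] by simp
  then show ?thesis using that by blast
qed

text \<open>Gram-Schmidt applied to a basis that begins with \<open>v\<close> leaves the first
  vector unchanged, so after normalisation the first column is still a multiple of
  \<open>v\<close>.\<close>

lemma orthonormal_extension:
  fixes v :: "real vec"
  assumes v: "v \<in> carrier_vec n" "v \<noteq> 0\<^sub>v n"
  obtains W c where "W \<in> carrier_mat n n" "W\<^sup>T * W = 1\<^sub>m n" "col W 0 = c \<cdot>\<^sub>v v"
proof -
  have n: "n > 0"
  proof (rule ccontr)
    assume "\<not> n > 0"
    then have "v = 0\<^sub>v n" using v(1) by (intro eq_vecI) auto
    then show False using v(2) by simp
  qed
  interpret cof_vec_space n "TYPE(real)" .
  define b where "b = basis_completion v"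
  from basis_completion[OF v, folded b_def]
  have dist_b: "distinct b" and indep: "\<not> lin_dep (set b)" and b: "set b \<subseteq> carrier_vec n"
    and hdb: "hd b = v" and len_b: "length b = n" by auto
  from hdb len_b n obtain vs where bv: "b = v # vs" by (cases b, auto)
  define ws where "ws = gram_schmidt n b"
  from gram_schmidt_result[OF b dist_b indep refl, folded ws_def]
  have ws: "set ws \<subseteq> carrier_vec n" "corthogonal ws" "length ws = n"
    by (auto simp: len_b)
  from gram_schmidt_hd[OF v(1), of vs, folded bv] have hdws: "hd ws = v" unfolding ws_def .
  define us where "us = map (\<lambda>w. (1 / sqrt (w \<bullet> w)) \<cdot>\<^sub>v w) ws"
  have wsc: "ws ! i \<in> carrier_vec n" if "i < n" for i using ws that by auto
  have conj: "conjugate w = w" for w :: "real vec"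
    by (rule eq_vecI) auto
  have orth: "(ws ! i \<bullet> ws ! j = 0) = (i \<noteq> j)" if "i < n" "j < n" for i j
    using corthogonalD[OF ws(2)] that ws(3) by (simp add: conj)
  have us: "us ! i \<bullet> us ! j = (if i = j then 1 else 0)" if ij: "i < n" "j < n" for i j
  proof (cases "i = j")
    case True
    have "ws ! i \<bullet> ws ! i \<ge> 0" by (simp add: scalar_prod_def sum_nonneg)
    then have "ws ! i \<bullet> ws ! i > 0" using orth[OF ij(1) ij(1)] by simp
    then show ?thesis using True ij wsc[of i] ws(3) by (simp add: us_def)
  next
    case False
    then show ?thesis using orth[OF ij] ij wsc[of i] wsc[of j] ws(3) by (simp add: us_def)
  qed
  have usc: "us ! i \<in> carrier_vec n" if "i < n" for i using wsc that ws(3) by (simp add: us_def)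
  let ?W = "mat_of_cols n us"
  have W: "?W \<in> carrier_mat n n" using ws(3) by (auto simp: us_def)
  have lus: "length us = n" using ws(3) by (simp add: us_def)
  have ws0: "ws ! 0 = v" using hdws n ws(3) by (cases ws) auto
  have "?W\<^sup>T * ?W = 1\<^sub>m n"
    by (rule eq_matI) (use W us usc lus in \<open>auto simp: col_mat_of_cols\<close>)
  moreover have "col ?W 0 = (1 / sqrt (v \<bullet> v)) \<cdot>\<^sub>v v"
    using n usc[of 0] lus ws(3) ws0 by (simp add: col_mat_of_cols us_def)
  ultimately show ?thesis using that W by blast
qed

text \<open>Deflation: conjugation by an orthogonal \<open>W\<close> whose first column is an
  eigenvector splits off a 1 x 1 block, and the remaining block \<open>A3\<close> is symmetric of
  order \<open>n\<close>.\<close>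

theorem real_spectral:
  fixes A :: "real mat"
  assumes "A \<in> carrier_mat n n"
    and "\<And>i j. i < n \<Longrightarrow> j < n \<Longrightarrow> A $$ (i, j) = A $$ (j, i)"
  shows "\<exists>U e. U \<in> carrier_mat n n \<and> U\<^sup>T * U = 1\<^sub>m n \<and> A = U * mat_diag n e * U\<^sup>T"
  using assms
proof (induction n arbitrary: A)
  case 0
  then show ?case
    by (intro exI[of _ "1\<^sub>m 0"]) (auto intro!: eq_matI)
next
  case (Suc n)
  note A = Suc.prems(1) and sym = Suc.prems(2)
  have AT: "A\<^sup>T = A" by (rule eq_matI) (use A sym in auto)
  obtain e where "eigenvalue A e" using symmetric_eigenvalue_exists[OF A _ sym] by blast
  then obtain v where v: "v \<in> carrier_vec (Suc n)" "v \<noteq> 0\<^sub>v (Suc n)" and ev: "A *\<^sub>v v = e \<cdot>\<^sub>v v"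
    using A by (auto simp: eigenvalue_def eigenvector_def)
  obtain W c where W: "W \<in> carrier_mat (Suc n) (Suc n)" "W\<^sup>T * W = 1\<^sub>m (Suc n)"
    and col0: "col W 0 = c \<cdot>\<^sub>v v"
    using orthonormal_extension[OF v] .
  have WT: "W\<^sup>T \<in> carrier_mat (Suc n) (Suc n)" using W by simp
  have WW: "W * W\<^sup>T = 1\<^sub>m (Suc n)" by (rule mat_mult_left_right_inverse[OF WT W])
  define B where "B = W\<^sup>T * (A * W)"
  have B: "B \<in> carrier_mat (Suc n) (Suc n)" using W A by (simp add: B_def)
  have BT: "B\<^sup>T = B"
    using W(1) A AT by (simp add: B_def transpose_mult[of _ "Suc n" "Suc n" _ "Suc n"]
        assoc_mult_mat[of _ "Suc n" "Suc n" _ "Suc n" _ "Suc n"])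
  have "B $$ (i, 0) = (if i = 0 then e else 0)" if i: "i < Suc n" for i
  proof -
    have "A *\<^sub>v col W 0 = e \<cdot>\<^sub>v col W 0"
      using A v by (simp add: col0 mult_mat_vec ev smult_smult_assoc mult.commute)
    then have "B $$ (i, 0) = col W i \<bullet> (e \<cdot>\<^sub>v col W 0)"
      using i W A col_mult2[OF A W(1), of 0] by (simp add: B_def)
    also have "\<dots> = e * (col W i \<bullet> col W 0)"
      using W by simp
    also have "col W i \<bullet> col W 0 = (W\<^sup>T * W) $$ (i, 0)" using i W(1) by simp
    finally show ?thesis using i W(2) by simp
  qed note Bcol = this
  have Bsym: "B $$ (i, j) = B $$ (j, i)" if "i < Suc n" "j < Suc n" for i j
    using arg_cong[OF BT, of "\<lambda>M. M $$ (i, j)"] that B by simp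
  define A3 where "A3 = mat n n (\<lambda>(i, j). B $$ (Suc i, Suc j))"
  have A3: "A3 \<in> carrier_mat n n" by (simp add: A3_def)
  have "\<exists>U e. U \<in> carrier_mat n n \<and> U\<^sup>T * U = 1\<^sub>m n \<and> A3 = U * mat_diag n e * U\<^sup>T"
    by (rule Suc.IH[OF A3]) (auto simp: A3_def Bsym)
  then obtain U f where U: "U \<in> carrier_mat n n" "U\<^sup>T * U = 1\<^sub>m n"
    and A3U: "A3 = U * mat_diag n f * U\<^sup>T" by blast
  define E1 where "E1 = mat_diag 1 (\<lambda>_. e)"
  have E1: "E1 \<in> carrier_mat 1 1" by (simp add: E1_def)
  have Bblock: "B = four_block_mat E1 (0\<^sub>m 1 n) (0\<^sub>m n 1) A3"
    by (rule eq_matI) (use B Bcol Bsym in \<open>auto simp: A3_def E1_def mat_diag_def\<close>)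
  \<comment> \<open>The orthogonal matrix that diagonalises \<open>A3\<close>, extended by the
    identity on the eigenvector already split off.\<close>
  define V where "V = four_block_mat (1\<^sub>m 1) (0\<^sub>m 1 n) (0\<^sub>m n 1) U"
  define g where "g = (\<lambda>i. if i = 0 then e else f (i - 1))"
  have V: "V \<in> carrier_mat (Suc n) (Suc n)"
    using four_block_carrier_mat[of "1\<^sub>m 1" 1 1 U n n] U by (simp add: V_def)
  have diag: "mat_diag (Suc n) g = four_block_mat E1 (0\<^sub>m 1 n) (0\<^sub>m n 1) (mat_diag n f)"
    by (rule eq_matI) (auto simp: E1_def mat_diag_def g_def)
  have VT: "V\<^sup>T = four_block_mat (1\<^sub>m 1) (0\<^sub>m 1 n) (0\<^sub>m n 1) U\<^sup>T"
    unfolding V_def by (subst transpose_four_block_mat) (use U in auto)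
  have UD: "U * mat_diag n f \<in> carrier_mat n n" using U by simp
  have UDU: "U * mat_diag n f * U\<^sup>T \<in> carrier_mat n n"
    by (rule mult_carrier_mat[OF UD]) (use U in simp)
  have VV: "V\<^sup>T * V = 1\<^sub>m (Suc n)"
    unfolding VT unfolding V_def
    by (subst mult_four_block_mat) (use U in auto)
  have "V * mat_diag (Suc n) g = four_block_mat E1 (0\<^sub>m 1 n) (0\<^sub>m n 1) (U * mat_diag n f)"
    unfolding diag unfolding V_def
    by (subst mult_four_block_mat)
      (use U E1 in \<open>auto simp: left_mult_zero_mat[OF mat_diag_dim] simp del: One_nat_def\<close>)
  moreover have "four_block_mat E1 (0\<^sub>m 1 n) (0\<^sub>m n 1) (U * mat_diag n f) * V\<^sup>T
      = four_block_mat E1 (0\<^sub>m 1 n) (0\<^sub>m n 1) (U * mat_diag n f * U\<^sup>T)"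
    unfolding VT by (subst mult_four_block_mat) (use U E1 UD in \<open>auto simp: right_mult_zero_mat[OF UD] left_add_zero_mat[OF UDU]
          simp del: One_nat_def\<close>)
  ultimately have BV: "B = V * mat_diag (Suc n) g * V\<^sup>T"
    unfolding Bblock A3U by simp
  have WV: "W * V \<in> carrier_mat (Suc n) (Suc n)" using W V by simp
  have "(W * V)\<^sup>T * (W * V) = V\<^sup>T * ((W\<^sup>T * W) * V)"
    using W(1) V by (simp add: transpose_mult[of _ "Suc n" "Suc n" _ "Suc n"]
        assoc_mult_mat[of _ "Suc n" "Suc n" _ "Suc n" _ "Suc n"])
  then have "(W * V)\<^sup>T * (W * V) = 1\<^sub>m (Suc n)" using W(2) VV V by simp
  moreover have "A = W * V * mat_diag (Suc n) g * (W * V)\<^sup>T"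
  proof -
    have D: "mat_diag (Suc n) g \<in> carrier_mat (Suc n) (Suc n)" by simp
    have "W * V * mat_diag (Suc n) g * (W * V)\<^sup>T = W * (B * W\<^sup>T)"
      unfolding BV using W(1) V D by (simp add: mult_carrier_mat[of _ "Suc n" "Suc n" _ "Suc n"]
        transpose_mult[of _ "Suc n" "Suc n" _ "Suc n"]
        assoc_mult_mat[of _ "Suc n" "Suc n" _ "Suc n" _ "Suc n"])
    also have "\<dots> = (W * W\<^sup>T) * A * (W * W\<^sup>T)"
      unfolding B_def using W(1) A by (simp add: 
        assoc_mult_mat[of _ "Suc n" "Suc n" _ "Suc n" _ "Suc n"])
    finally show ?thesis using WW A by simp
  qed
  ultimately show ?case using WV by blast
qed

lemma proots_prod_list_linear:
  "proots (\<Prod>a\<leftarrow>xs. [:- a, 1 :: real:]) = mset xs"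
proof (induction xs)
  case (Cons a xs)
  have "(\<Prod>a\<leftarrow>xs. [:- a, 1 :: real:]) \<noteq> 0" by (auto simp: prod_list_zero_iff)
  then show ?case using Cons by (simp add: proots_mult del: mult_pCons_left)
qed simp

text \<open>Entrywise form of \<open>real_spectral\<close>: \<open>f k\<close> is the k-th column of
  \<open>U\<close>, and the two relations say that columns and rows are orthonormal. Similarity to a
  diagonal matrix gives the roots with their multiplicities.\<close>

lemma real_spectral_proots:
  fixes A :: "real mat"
  assumes A: "A \<in> carrier_mat n n"
    and sym: "\<And>i j. i < n \<Longrightarrow> j < n \<Longrightarrow> A $$ (i, j) = A $$ (j, i)"
  obtains f :: "nat \<Rightarrow> nat \<Rightarrow> real" and e :: "nat \<Rightarrow> real"
  where "\<forall>i<n. \<forall>j<n. A $$ (i, j) = (\<Sum>k<n. e k * f k i * f k j)"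
    and "\<forall>k<n. \<forall>l<n. (\<Sum>i<n. f k i * f l i) = of_bool (k = l)"
    and "\<forall>i<n. \<forall>j<n. (\<Sum>k<n. f k i * f k j) = of_bool (i = j)"
    and "proots (char_poly A) = image_mset e (mset_set {..<n})"
proof -
  obtain U e where U: "U \<in> carrier_mat n n" and UU: "U\<^sup>T * U = 1\<^sub>m n"
    and AU: "A = U * mat_diag n e * U\<^sup>T"
    using real_spectral[OF A sym] by blast
  have UT: "U\<^sup>T \<in> carrier_mat n n" using U by simp
  have UU': "U * U\<^sup>T = 1\<^sub>m n" by (rule mat_mult_left_right_inverse[OF UT U UU])
  have 1: "A $$ (i, j) = (\<Sum>k<n. e k * U $$ (i, k) * U $$ (j, k))" if "i < n" "j < n" for i j
    unfolding AU using that U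
    by (simp add: mat_diag_mult_right[OF U] scalar_prod_def lessThan_atLeast0 mult_ac)
  have 2: "(\<Sum>i<n. U $$ (i, k) * U $$ (i, l)) = of_bool (k = l)" if "k < n" "l < n" for k l
    using arg_cong[OF UU, of "\<lambda>M. M $$ (k, l)"] that U
    by (simp add: scalar_prod_def lessThan_atLeast0)
  have 3: "(\<Sum>k<n. U $$ (i, k) * U $$ (j, k)) = of_bool (i = j)" if "i < n" "j < n" for i j
    using arg_cong[OF UU', of "\<lambda>M. M $$ (i, j)"] that U
    by (simp add: scalar_prod_def lessThan_atLeast0)
  have D: "mat_diag n e \<in> carrier_mat n n" by simp
  have "similar_mat A (mat_diag n e)"
    unfolding similar_mat_def
    by (rule exI[of _ U], rule exI[of _ "U\<^sup>T"], rule similar_mat_witI[of _ _ n])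
      (use U A UU UU' AU in auto)
  then have "char_poly A = char_poly (mat_diag n e)" by (rule char_poly_similar)
  also have "\<dots> = (\<Prod>a\<leftarrow>diag_mat (mat_diag n e). [:- a, 1:])"
    by (rule char_poly_upper_triangular[OF D]) (auto simp: mat_diag_def)
  also have "diag_mat (mat_diag n e) = map e [0..<n]"
    by (auto simp: diag_mat_def mat_diag_def)
  finally have "proots (char_poly A) = mset (map e [0..<n])"
    using proots_prod_list_linear[of "map e [0..<n]"] by simp
  then have 4: "proots (char_poly A) = image_mset e (mset_set {..<n})"
    by (simp add: lessThan_atLeast0)
  show ?thesis
    by (rule that[of e "\<lambda>k i. U $$ (i, k)"]) (use 1 2 3 4 in auto)
qed

section \<open>Rank and inertia\<close>

lemma linear_dependency2:
  fixes a b :: real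
  shows "\<exists>x y. (x \<noteq> 0 \<or> y \<noteq> 0) \<and> a * x + b * y = 0"
proof (cases "a = 0")
  case True
  then show ?thesis by (intro exI[of _ 1] exI[of _ 0]) simp
next
  case False
  then show ?thesis by (intro exI[of _ b] exI[of _ "- a"]) simp
qed

text \<open>It supplies a nonzero combination of three vectors that is annihilated by two given
  linear functionals.\<close>

lemma linear_dependency3:
  fixes a1 a2 a3 b1 b2 b3 :: real
  shows "\<exists>x y z. (x \<noteq> 0 \<or> y \<noteq> 0 \<or> z \<noteq> 0) \<and> a1 * x + a2 * y + a3 * z = 0
    \<and> b1 * x + b2 * y + b3 * z = 0"
proof -
  have *: "\<exists>x y z. (x \<noteq> 0 \<or> y \<noteq> 0 \<or> z \<noteq> 0) \<and> a1 * x + a2 * y + a3 * z = 0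
    \<and> b1 * x + b2 * y + b3 * z = 0" if "a3 \<noteq> 0" for a1 a2 a3 b1 b2 b3 :: real
  proof -
    obtain x y where xy: "x \<noteq> 0 \<or> y \<noteq> 0"
      "(b1 - b3 * a1 / a3) * x + (b2 - b3 * a2 / a3) * y = 0"
      using linear_dependency2 by metis
    define z where "z = - (a1 * x + a2 * y) / a3"
    have "b1 * x + b2 * y + b3 * z = (b1 - b3 * a1 / a3) * x + (b2 - b3 * a2 / a3) * y"
      by (simp add: z_def algebra_simps add_divide_distrib diff_divide_distrib)
    moreover have "a1 * x + a2 * y + a3 * z = 0" using that by (simp add: z_def)
    ultimately show ?thesis using xy by metis
  qed
  show ?thesis
  proof (cases "a3 = 0")
    case True
    show ?thesis
    proof (cases "b3 = 0")
      case True
      with \<open>a3 = 0\<close> show ?thesis by (intro exI[of _ 0] exI[of _ 1]) auto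
    next
      case False
      then show ?thesis using *[of b3 b1 b2 a1 a2 a3] by blast
    qed
  qed (use * in blast)
qed

text \<open>Sylvester's criterion in dimension 3: multiplied by its first two leading minors, the
  form becomes a sum of squares with positive coefficients.\<close>

lemma pos_def3:
  fixes A B C D E F x y z :: real
  assumes "A > 0" "A * B - D\<^sup>2 > 0"
    and "A * (B * C - F\<^sup>2) - D * (D * C - F * E) + E * (D * F - B * E) > 0"
    and le: "A * x\<^sup>2 + B * y\<^sup>2 + C * z\<^sup>2 + 2 * D * x * y + 2 * E * x * z + 2 * F * y * z \<le> 0"
  shows "x = 0 \<and> y = 0 \<and> z = 0"
proof -
  let ?d = "A * B - D\<^sup>2"
  let ?g = "A * (B * C - F\<^sup>2) - D * (D * C - F * E) + E * (D * F - B * E)"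
  let ?Q = "A * x\<^sup>2 + B * y\<^sup>2 + C * z\<^sup>2 + 2 * D * x * y + 2 * E * x * z + 2 * F * y * z"
  have eq: "A * ?d * ?Q = ?d * (A * x + D * y + E * z)\<^sup>2 + (?d * y + (A * F - D * E) * z)\<^sup>2 + A * ?g * z\<^sup>2"
    by (simp add: power2_eq_square algebra_simps)
  have "A * ?d * ?Q \<le> 0" using assms by (simp add: mult_nonneg_nonpos)
  moreover have "?d * (A * x + D * y + E * z)\<^sup>2 \<ge> 0" "(?d * y + (A * F - D * E) * z)\<^sup>2 \<ge> 0"
    "A * ?g * z\<^sup>2 \<ge> 0" using assms by simp_all
  ultimately have "?d * (A * x + D * y + E * z)\<^sup>2 = 0" "(?d * y + (A * F - D * E) * z)\<^sup>2 = 0"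
    "A * ?g * z\<^sup>2 = 0" unfolding eq by linarith+
  then show ?thesis using assms by auto
qed

text \<open>The left-hand side is the Gram determinant, expanded along the first row, of three
  vectors of the plane with coordinates \<open>f\<close> and \<open>g\<close>; such vectors are
  linearly dependent.\<close>

lemma plane_gram_det:
  fixes f g :: "'a \<Rightarrow> real"
  assumes "\<And>u v. u \<in> {a, b, c} \<Longrightarrow> v \<in> {a, b, c} \<Longrightarrow> M u v = f u * f v + g u * g v"
  shows "M a a * (M b b * M c c - (M b c)\<^sup>2) - M a b * (M a b * M c c - M b c * M a c)
    + M a c * (M a b * M b c - M b b * M a c) = 0"
proof -
  have "M a a = f a * f a + g a * g a" "M b b = f b * f b + g b * g b" "M c c = f c * f c + g c * g c"
    "M a b = f a * f b + g a * g b" "M a c = f a * f c + g a * g c" "M b c = f b * f c + g b * g c"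
    using assms by simp_all
  then show ?thesis by (simp add: power2_eq_square algebra_simps)
qed

definition form :: "'a set \<Rightarrow> ('a \<Rightarrow> 'a \<Rightarrow> real) \<Rightarrow> ('a \<Rightarrow> real) \<Rightarrow> real" where
  "form V K x = (\<Sum>u\<in>V. \<Sum>v\<in>V. x u * x v * K u v)"

text \<open>The argument is a combination of unit vectors at the points \<open>p i\<close>, so that
  a test vector of small support can be evaluated as a small explicit sum.\<close>

lemma form_points:
  assumes "finite V" "\<And>i. i < m \<Longrightarrow> p i \<in> V"
  shows "form V K (\<lambda>w. \<Sum>i<m. a i * of_bool (w = p i)) = (\<Sum>i<m. \<Sum>j<m. a i * a j * K (p i) (p j))"
proof -
  have *: "(\<Sum>u\<in>V. (\<Sum>i<m. a i * of_bool (u = p i)) * h u) = (\<Sum>i<m. a i * h (p i))" for h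
  proof -
    have "(\<Sum>u\<in>V. (\<Sum>i<m. a i * of_bool (u = p i)) * h u)
      = (\<Sum>u\<in>V. \<Sum>i<m. a i * of_bool (u = p i) * h u)"
      by (simp add: sum_distrib_right)
    also have "\<dots> = (\<Sum>i<m. \<Sum>u\<in>V. a i * of_bool (u = p i) * h u)" by (rule sum.swap)
    also have "\<dots> = (\<Sum>i<m. a i * h (p i))"
    proof (intro sum.cong refl)
      fix i assume "i \<in> {..<m}"
      then have "p i \<in> V" using assms by simp
      have "(\<Sum>u\<in>V. a i * of_bool (u = p i) * h u) = (\<Sum>u\<in>V. if u = p i then a i * h u else 0)"
        by (intro sum.cong) auto
      also have "\<dots> = a i * h (p i)" using \<open>p i \<in> V\<close> assms(1) by simp
      finally show "(\<Sum>u\<in>V. a i * of_bool (u = p i) * h u) = a i * h (p i)" .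
    qed
    finally show ?thesis .
  qed
  let ?x = "\<lambda>w. \<Sum>i<m. a i * of_bool (w = p i)"
  have "form V K ?x = (\<Sum>u\<in>V. ?x u * (\<Sum>v\<in>V. ?x v * K u v))"
    unfolding form_def by (simp add: sum_distrib_left mult_ac)
  also have "\<dots> = (\<Sum>i<m. a i * (\<Sum>j<m. a j * K (p i) (p j)))" by (simp only: *)
  finally show ?thesis by (simp add: sum_distrib_left mult_ac)
qed

section \<open>The rank of \<open>(D + I) (D + 3 I)\<close>\<close>

locale spectral_decomposition =
  fixes V :: "'a set" and D :: "'a \<Rightarrow> 'a \<Rightarrow> real" and n :: nat
    and e :: "nat \<Rightarrow> real" and F :: "nat \<Rightarrow> 'a \<Rightarrow> real"
  assumes finV: "finite V"
    and D_eq: "u \<in> V \<Longrightarrow> v \<in> V \<Longrightarrow> D u v = (\<Sum>k<n. e k * F k u * F k v)"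
    and orth: "k < n \<Longrightarrow> l < n \<Longrightarrow> (\<Sum>u\<in>V. F k u * F l u) = of_bool (k = l)"
    and compl: "u \<in> V \<Longrightarrow> v \<in> V \<Longrightarrow> (\<Sum>k<n. F k u * F k v) = of_bool (u = v)"
begin

text \<open>The entries of \<open>(D + I) (D + 3 I)\<close>, multiplied out. Its eigenvalue at
  \<open>F k\<close> is \<open>c k\<close>, which vanishes exactly when \<open>k\<close> is not in
  \<open>exc\<close>.\<close>

definition "M u v = (\<Sum>w\<in>V. D u w * D w v) + 4 * D u v + 3 * of_bool (u = v)"

definition "c k = (e k + 1) * (e k + 3)"

definition "exc = {k. k < n \<and> e k \<noteq> -1 \<and> e k \<noteq> -3}"

lemma finite_exc: "finite exc" by (simp add: exc_def)

lemma c_eq_0_iff: "k < n \<Longrightarrow> c k = 0 \<longleftrightarrow> k \<notin> exc"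
  by (auto simp: c_def exc_def)

lemma M_eq:
  assumes uv: "u \<in> V" "v \<in> V"
  shows "M u v = (\<Sum>k<n. c k * F k u * F k v)"
proof -
  have "(\<Sum>w\<in>V. D u w * D w v)
    = (\<Sum>w\<in>V. \<Sum>k<n. \<Sum>l<n. e k * e l * F k u * F l v * (F k w * F l w))"
    using uv by (simp add: D_eq sum_product mult_ac cong: sum.cong)
  also have "\<dots> = (\<Sum>k<n. \<Sum>w\<in>V. \<Sum>l<n. e k * e l * F k u * F l v * (F k w * F l w))"
    by (rule sum.swap)
  also have "\<dots> = (\<Sum>k<n. \<Sum>l<n. \<Sum>w\<in>V. e k * e l * F k u * F l v * (F k w * F l w))"
    by (intro sum.cong refl) (rule sum.swap)
  also have "\<dots> = (\<Sum>k<n. \<Sum>l<n. if k = l then e k * e l * F k u * F l v else 0)"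
    by (intro sum.cong refl) (simp add: sum_distrib_left[symmetric] orth)
  also have "\<dots> = (\<Sum>k<n. e k * e k * F k u * F k v)" by simp
  finally have "M u v = (\<Sum>k<n. e k * e k * F k u * F k v) + 4 * (\<Sum>k<n. e k * F k u * F k v)
      + 3 * (\<Sum>k<n. F k u * F k v)"
    using uv by (simp add: M_def D_eq compl)
  moreover have "(\<Sum>k<n. c k * F k u * F k v)
    = (\<Sum>k<n. e k * e k * F k u * F k v + 4 * (e k * F k u * F k v) + 3 * (F k u * F k v))"
    by (intro sum.cong refl) (simp add: c_def algebra_simps)
  ultimately show ?thesis by (simp add: sum.distrib sum_distrib_left)
qed

text \<open>The eigenvalues -1 and -3 contribute nothing, so the rank of \<open>M\<close> is the
  number of exceptional indices.\<close>

lemma M_exc: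
  assumes uv: "u \<in> V" "v \<in> V"
  shows "M u v = (\<Sum>k\<in>exc. c k * F k u * F k v)"
  unfolding M_eq[OF uv]
  by (rule sum.mono_neutral_right) (auto simp: exc_def c_def)

lemma M_mult_F:
  assumes "k < n" "u \<in> V"
  shows "(\<Sum>v\<in>V. M u v * F k v) = c k * F k u"
proof -
  have "(\<Sum>v\<in>V. M u v * F k v) = (\<Sum>v\<in>V. \<Sum>l<n. c l * F l u * (F l v * F k v))"
    using assms by (intro sum.cong refl) (simp add: M_eq sum_distrib_left mult_ac)
  also have "\<dots> = (\<Sum>l<n. \<Sum>v\<in>V. c l * F l u * (F l v * F k v))" by (rule sum.swap)
  also have "\<dots> = (\<Sum>l<n. if l = k then c l * F l u else 0)"
    using assms by (intro sum.cong refl) (simp add: sum_distrib_left[symmetric] orth)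
  also have "\<dots> = c k * F k u" using assms by simp
  finally show ?thesis .
qed

lemma form_eq: "form V (\<lambda>u v. D u v + s * of_bool (u = v)) x = (\<Sum>k<n. (e k + s) * (\<Sum>u\<in>V. x u * F k u)\<^sup>2)"
proof -
  have *: "D u v + s * of_bool (u = v) = (\<Sum>k<n. (e k + s) * (F k u * F k v))"
    if "u \<in> V" "v \<in> V" for u v
    unfolding D_eq[OF that] compl[OF that, symmetric] sum_distrib_left
    by (simp add: distrib_right sum.distrib mult.assoc)
  have "form V (\<lambda>u v. D u v + s * of_bool (u = v)) x
    = (\<Sum>u\<in>V. \<Sum>v\<in>V. \<Sum>k<n. (e k + s) * (x u * F k u) * (x v * F k v))"
    unfolding form_def
    by (intro sum.cong refl) (simp add: * sum_distrib_left mult_ac)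
  also have "\<dots> = (\<Sum>u\<in>V. \<Sum>k<n. \<Sum>v\<in>V. (e k + s) * (x u * F k u) * (x v * F k v))"
    by (intro sum.cong refl) (rule sum.swap)
  also have "\<dots> = (\<Sum>k<n. \<Sum>u\<in>V. \<Sum>v\<in>V. (e k + s) * (x u * F k u) * (x v * F k v))"
    by (rule sum.swap)
  also have "\<dots> = (\<Sum>k<n. (e k + s) * (\<Sum>u\<in>V. x u * F k u)\<^sup>2)"
    by (intro sum.cong refl)
      (simp add: power2_eq_square sum_product sum_distrib_left mult_ac)
  finally show ?thesis .
qed

text \<open>If \<open>M\<close> is an outer product, some nontrivial combination of two exceptional
  eigenvectors is annihilated by \<open>M\<close>. Pairing its image with either eigenvector shows
  that both coefficients vanish.\<close>

lemma card_exc_le_1: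
  assumes "\<And>u v. u \<in> V \<Longrightarrow> v \<in> V \<Longrightarrow> M u v = l u * a v"
  shows "card exc \<le> 1"
proof (rule ccontr)
  assume "\<not> card exc \<le> 1"
  then obtain i j where ij: "i \<in> exc" "j \<in> exc" "i \<noteq> j"
    using card_le_Suc0_iff_eq[OF finite_exc] by auto
  then have lt: "i < n" "j < n" by (auto simp: exc_def)
  obtain x y where xy: "x \<noteq> 0 \<or> y \<noteq> 0"
    and 0: "(\<Sum>v\<in>V. a v * F i v) * x + (\<Sum>v\<in>V. a v * F j v) * y = 0"
    using linear_dependency2 by blast
  have *: "x * c i * F i u + y * c j * F j u = 0" if u: "u \<in> V" for u
  proof -
    have "x * c i * F i u + y * c j * F j u = x * (\<Sum>v\<in>V. M u v * F i v) + y * (\<Sum>v\<in>V. M u v * F j v)"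
      using lt u by (simp add: M_mult_F)
    also have "\<dots> = l u * ((\<Sum>v\<in>V. a v * F i v) * x + (\<Sum>v\<in>V. a v * F j v) * y)"
      using u by (simp add: assms sum_distrib_left sum_distrib_right algebra_simps cong: sum.cong)
    finally show ?thesis using 0 by simp
  qed
  have "(\<Sum>u\<in>V. (x * c i * F i u + y * c j * F j u) * F k u) = x * c i * of_bool (i = k) + y * c j * of_bool (j = k)"
    if "k < n" for k
  proof -
    have "(\<Sum>u\<in>V. (x * c i * F i u + y * c j * F j u) * F k u)
      = x * c i * (\<Sum>u\<in>V. F i u * F k u) + y * c j * (\<Sum>u\<in>V. F j u * F k u)"
      by (simp add: sum_distrib_left sum.distrib distrib_right mult.assoc)
    then show ?thesis using that lt by (simp add: orth)
  qed
  from this[OF lt(1)] this[OF lt(2)] have "x * c i = 0" "y * c j = 0" using ij * by simp_all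
  then show False using xy ij c_eq_0_iff lt by simp
qed

text \<open>As for \<open>card_exc_le_1\<close>, with three exceptional eigenvectors: the two linear
  conditions given by \<open>a\<close> and \<open>b\<close> still leave a nontrivial combination in
  the kernel of \<open>M\<close>.\<close>

lemma card_exc_le_2:
  assumes "\<And>u v. u \<in> V \<Longrightarrow> v \<in> V \<Longrightarrow> M u v = l u * a v + m u * b v"
  shows "card exc \<le> 2"
proof (rule ccontr)
  assume "\<not> card exc \<le> 2"
  then have "3 \<le> card exc" by simp
  then obtain S where "S \<subseteq> exc" "card S = 3" using obtain_subset_with_card_n by metis
  then obtain i j k where ijk: "i \<in> exc" "j \<in> exc" "k \<in> exc" "i \<noteq> j" "i \<noteq> k" "j \<noteq> k"
    by (auto simp: card_3_iff)
  then have lt: "i < n" "j < n" "k < n" by (auto simp: exc_def)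
  obtain x y z where xyz: "x \<noteq> 0 \<or> y \<noteq> 0 \<or> z \<noteq> 0"
    and 0: "(\<Sum>v\<in>V. a v * F i v) * x + (\<Sum>v\<in>V. a v * F j v) * y + (\<Sum>v\<in>V. a v * F k v) * z = 0"
      "(\<Sum>v\<in>V. b v * F i v) * x + (\<Sum>v\<in>V. b v * F j v) * y + (\<Sum>v\<in>V. b v * F k v) * z = 0"
    using linear_dependency3 by blast
  have *: "x * c i * F i u + y * c j * F j u + z * c k * F k u = 0" if u: "u \<in> V" for u
  proof -
    have "x * c i * F i u + y * c j * F j u + z * c k * F k u = x * (\<Sum>v\<in>V. M u v * F i v)
        + y * (\<Sum>v\<in>V. M u v * F j v) + z * (\<Sum>v\<in>V. M u v * F k v)"
      using lt u by (simp add: M_mult_F)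
    also have "\<dots> = l u * ((\<Sum>v\<in>V. a v * F i v) * x + (\<Sum>v\<in>V. a v * F j v) * y + (\<Sum>v\<in>V. a v * F k v) * z)
      + m u * ((\<Sum>v\<in>V. b v * F i v) * x + (\<Sum>v\<in>V. b v * F j v) * y + (\<Sum>v\<in>V. b v * F k v) * z)"
      using u by (simp add: assms sum_distrib_left sum_distrib_right sum.distrib algebra_simps cong: sum.cong)
    finally show ?thesis using 0 by simp
  qed
  have "(\<Sum>u\<in>V. (x * c i * F i u + y * c j * F j u + z * c k * F k u) * F h u)
      = x * c i * of_bool (i = h) + y * c j * of_bool (j = h) + z * c k * of_bool (k = h)"
    if "h < n" for h
  proof -
    have "(\<Sum>u\<in>V. (x * c i * F i u + y * c j * F j u + z * c k * F k u) * F h u)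
      = x * c i * (\<Sum>u\<in>V. F i u * F h u) + y * c j * (\<Sum>u\<in>V. F j u * F h u)
        + z * c k * (\<Sum>u\<in>V. F k u * F h u)"
      by (simp add: sum_distrib_left sum.distrib distrib_right mult.assoc)
    then show ?thesis using that lt by (simp add: orth)
  qed
  from this[OF lt(1)] this[OF lt(2)] this[OF lt(3)]
  have "x * c i = 0" "y * c j = 0" "z * c k = 0" using ijk * by simp_all
  then show False using xyz ijk c_eq_0_iff lt by simp
qed

text \<open>With at most one exceptional index, \<open>M\<close> is a multiple of the outer square
  of one vector, and every 2 x 2 minor vanishes.\<close>

lemma card_exc_ge_2:
  assumes uv: "u \<in> V" "v \<in> V" and "M u u * M v v - (M u v)\<^sup>2 \<noteq> 0"
  shows "card exc \<ge> 2"
proof (rule ccontr)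
  assume "\<not> card exc \<ge> 2"
  then have "card exc = 0 \<or> card exc = 1" by linarith
  then have "exc = {} \<or> (\<exists>k. exc = {k})"
    using finite_exc by (metis card_0_eq card_1_singletonE)
  then have "M u u * M v v - (M u v)\<^sup>2 = 0"
    using uv by (auto simp: M_exc power2_eq_square)
  then show False using assms by simp
qed

text \<open>The criterion for the converse direction: the minor bounds the rank from below, the
  expression of all rows by those of \<open>u\<close> and \<open>v\<close> bounds it from
  above.\<close>

lemma card_exc_eq_2:
  assumes "u \<in> V" "v \<in> V" "M u u * M v v - (M u v)\<^sup>2 \<noteq> 0"
    and "\<And>w w'. w \<in> V \<Longrightarrow> w' \<in> V \<Longrightarrow> M w w' = l w * M u w' + m w * M v w'"
  shows "card exc = 2"
  using card_exc_ge_2[OF assms(1-3)] card_exc_le_2[of l "M u" m "M v", OF assms(4)] by linarith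

end

section \<open>Two exceptional eigenvalues, both greater than -1\<close>

locale two_exceptional = spectral_decomposition +
  fixes k1 k2
  assumes exc2: "exc = {k1, k2}" "k1 \<noteq> k2"
    and above: "e k1 > -1" "e k2 > -1"
begin

lemma e_other:
  assumes "k < n" "k \<noteq> k1" "k \<noteq> k2"
  shows "e k = -1 \<or> e k = -3"
proof -
  have "k \<notin> exc" unfolding exc2(1) using assms by simp
  then show ?thesis using assms(1) unfolding exc_def by simp
qed

text \<open>Every eigenvalue is -1, -3 or one of the two that exceed -1, hence at least -3.\<close>

lemma form3_nonneg: "form V (\<lambda>u v. D u v + 3 * of_bool (u = v)) x \<ge> 0"
proof -
  have "e k + 3 \<ge> 0" if "k < n" for k
  proof (cases "k = k1 \<or> k = k2")
    case True
    then show ?thesis using above by auto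
  next
    case False
    then show ?thesis using e_other[OF that] by auto
  qed
  then show ?thesis unfolding form_eq by (auto intro!: sum_nonneg)
qed

text \<open>\<open>D + I\<close> has only two positive eigenvalues. A suitable combination of the
  three vectors is orthogonal to \<open>F k1\<close> and \<open>F k2\<close>, and there the form is
  nonpositive.\<close>

lemma form1_nonpos:
  obtains a b d where "a \<noteq> 0 \<or> b \<noteq> 0 \<or> d \<noteq> 0"
    "form V (\<lambda>u v. D u v + of_bool (u = v)) (\<lambda>u. a * x u + b * y u + d * z u) \<le> 0"
proof -
  let ?d = "\<lambda>x k. \<Sum>u\<in>V. x u * F k u"
  obtain a b d where abd: "a \<noteq> 0 \<or> b \<noteq> 0 \<or> d \<noteq> 0"
    and 0: "?d x k1 * a + ?d y k1 * b + ?d z k1 * d = 0" "?d x k2 * a + ?d y k2 * b + ?d z k2 * d = 0"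
    using linear_dependency3[of "?d x k1" "?d y k1" "?d z k1" "?d x k2" "?d y k2" "?d z k2"] by blast
  let ?w = "\<lambda>u. a * x u + b * y u + d * z u"
  have w: "?d ?w k = a * ?d x k + b * ?d y k + d * ?d z k" for k
    by (simp only: distrib_right sum.distrib sum_distrib_left mult.assoc)
  have "(e k + 1) * (?d ?w k)\<^sup>2 \<le> 0" if "k < n" for k
  proof (cases "k = k1 \<or> k = k2")
    case True
    then have "?d ?w k = 0" using 0 unfolding w by (auto simp: mult.commute)
    then show ?thesis by simp
  next
    case False
    then show ?thesis using e_other[OF that] by (intro mult_nonpos_nonneg) auto
  qed
  then have "form V (\<lambda>u v. D u v + 1 * of_bool (u = v)) ?w \<le> 0"
    unfolding form_eq by (auto intro!: sum_nonpos)
  then show ?thesis using that[OF abd] by simp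
qed

text \<open>Both \<open>c k1\<close> and \<open>c k2\<close> are positive because the eigenvalues
  exceed -1; scaling the two eigenvectors by the square roots gives plane coordinates.\<close>

lemma M_plane:
  obtains f g where "\<And>u v. u \<in> V \<Longrightarrow> v \<in> V \<Longrightarrow> M u v = f u * f v + g u * g v"
proof
  have sqrt: "sqrt (c k) * x * (sqrt (c k) * y) = c k * x * y" if "e k > -1" for k x y
  proof -
    have "sqrt (c k) * sqrt (c k) = c k" using that by (simp add: c_def)
    moreover have "sqrt (c k) * x * (sqrt (c k) * y) = sqrt (c k) * sqrt (c k) * x * y"
      by (simp only: mult_ac)
    ultimately show ?thesis by simp
  qed
  show "M u v = sqrt (c k1) * F k1 u * (sqrt (c k1) * F k1 v) + sqrt (c k2) * F k2 u * (sqrt (c k2) * F k2 v)"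
    if "u \<in> V" "v \<in> V" for u v
    unfolding M_exc[OF that] exc2(1) sqrt[OF above(1)] sqrt[OF above(2)]
    by (subst sum.insert) (use exc2(2) in auto)
qed

end

context spectral_decomposition
begin

text \<open>The vertices \<open>u\<close>, \<open>v\<close>, \<open>w\<close> form a shortest path
  of length 2. If one exceptional eigenvalue were at most -1, then \<open>D + I\<close> would be
  nonpositive on the complement of the other eigenvector. This complement meets the plane spanned by
  the unit vector at \<open>v\<close> and the sum of those at \<open>u\<close> and \<open>w\<close>,
  where the form is \<open>2 * a\<^sup>2 + (2 * a + b)\<^sup>2\<close>.\<close>

lemma two_exceptionalI:
  assumes card: "card exc = 2"
    and uvw: "u \<in> V" "v \<in> V" "w \<in> V"
    and D: "D u u = 0" "D v v = 0" "D w w = 0" "D u v = 1" "D v u = 1" "D v w = 1" "D w v = 1"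
      "D u w = 2" "D w u = 2"
    and dist: "u \<noteq> v" "u \<noteq> w" "v \<noteq> w"
  shows "\<exists>k1 k2. two_exceptional V D n e F k1 k2"
proof -
  have *: "e i > -1" if ij: "exc = {i, j}" "i \<noteq> j" for i j
  proof (rule ccontr)
    assume "\<not> e i > -1"
    let ?d = "\<lambda>x k. \<Sum>u\<in>V. x u * F k u"
    let ?x = "\<lambda>t. of_bool (t = u) + of_bool (t = w) :: real" and ?y = "\<lambda>t. of_bool (t = v) :: real"
    obtain a b where ab: "a \<noteq> 0 \<or> b \<noteq> 0" and 0: "?d ?x j * a + ?d ?y j * b = 0"
      using linear_dependency2[of "?d ?x j" "?d ?y j"] by blast
    let ?w = "\<lambda>t. a * ?x t + b * ?y t"
    have w: "?d (\<lambda>t. a * x t + b * y t) k = a * ?d x k + b * ?d y k" for x y k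
      by (simp only: distrib_right sum.distrib sum_distrib_left mult.assoc)
    have "(e k + 1) * (?d ?w k)\<^sup>2 \<le> 0" if "k < n" for k
    proof (cases "k = j")
      case True
      then have "?d ?w k = 0" using 0 w[of ?x ?y k] by (simp add: mult.commute)
      then show ?thesis by simp
    next
      case False
      have "e k + 1 \<le> 0"
      proof (cases "k = i")
        case True
        then show ?thesis using \<open>\<not> e i > -1\<close> by simp
      next
        case ki: False
        have "k \<notin> exc" unfolding ij(1) using ki False by simp
        then have "e k = -1 \<or> e k = -3" using that unfolding exc_def by simp
        then show ?thesis by linarith
      qed
      then show ?thesis by (auto simp: mult_nonpos_nonneg)
    qed
    then have le: "form V (\<lambda>u v. D u v + 1 * of_bool (u = v)) ?w \<le> 0"
      unfolding form_eq by (auto intro!: sum_nonpos)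
    let ?p = "(!) [u, v, w]" and ?a = "(!) [a, b, a]"
    have "?w = (\<lambda>t. \<Sum>i<3. ?a i * of_bool (t = ?p i))"
      by (rule ext) (simp add: eval_nat_numeral lessThan_Suc algebra_simps)
    moreover have "?p i \<in> V" if "i < 3" for i
      using that uvw by (auto simp: eval_nat_numeral less_Suc_eq)
    ultimately have "form V (\<lambda>u v. D u v + 1 * of_bool (u = v)) ?w
      = (\<Sum>i<3. \<Sum>j<3. ?a i * ?a j * (D (?p i) (?p j) + 1 * of_bool (?p i = ?p j)))"
      using form_points[OF finV, of 3 ?p] by simp
    also have "\<dots> = 6 * a\<^sup>2 + 4 * a * b + b\<^sup>2"
      using D dist by (simp add: eval_nat_numeral lessThan_Suc algebra_simps power2_eq_square)
    also have "\<dots> = 2 * a\<^sup>2 + (2 * a + b)\<^sup>2" by (simp add: power2_eq_square algebra_simps)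
    finally have "2 * a\<^sup>2 + (2 * a + b)\<^sup>2 \<le> 0" using le by simp
    then have "a\<^sup>2 = 0" "(2 * a + b)\<^sup>2 = 0"
      using zero_le_power2[of a] zero_le_power2[of "2 * a + b"] by linarith+
    then show False using ab by auto
  qed
  obtain i j where ij: "exc = {i, j}" "i \<noteq> j" using card by (auto simp: card_2_iff)
  have "two_exceptional V D n e F i j"
    using *[OF ij] *[of j i] ij by unfold_locales (simp_all add: insert_commute)
  then show ?thesis by blast
qed

end

section \<open>Unions of two complete multipartite graphs\<close>

text \<open>The two sides of the vertex set are given by the values of the predicate \<open>S\<close>.\<close>

locale two_multipartite =
  fixes V :: "'a set" and H :: "'a \<Rightarrow> 'a \<Rightarrow> bool" and S :: "'a \<Rightarrow> bool"
  assumes finite_V: "finite V"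
    and H_V: "H u v \<Longrightarrow> u \<in> V"
    and H_irrefl: "\<not> H u u"
    and H_sym: "H u v \<Longrightarrow> H v u"
    and H_side: "H u v \<Longrightarrow> S u = S v"
    and H_trans: "H u v \<Longrightarrow> w \<in> V \<Longrightarrow> S w = S u \<Longrightarrow> H w u \<or> H w v"
begin

definition "side u = {w \<in> V. S w = S u}"

text \<open>By \<open>H_trans\<close>, nonadjacency is an equivalence relation on each side; for a
  vertex \<open>u\<close> this is its class.\<close>

definition "part u = {w \<in> side u. \<not> H u w}"

lemma H_V2: "H u v \<Longrightarrow> v \<in> V" using H_V H_sym by blast

lemma finite_side [simp]: "finite (side u)" by (simp add: side_def finite_V)

lemma part_subset: "part u \<subseteq> side u" by (auto simp: part_def)

lemma finite_part [simp]: "finite (part u)" by (rule finite_subset[OF part_subset]) simp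

lemma self_in_part: "u \<in> V \<Longrightarrow> u \<in> part u"
  by (auto simp: part_def side_def H_irrefl)

lemma card_part_pos: "u \<in> V \<Longrightarrow> card (part u) > 0"
  using self_in_part by (auto simp: card_gt_0_iff)

lemma card_part_le: "card (part u) \<le> card (side u)"
  by (simp add: card_mono part_subset)

lemma part_sym: "u \<in> V \<Longrightarrow> v \<in> part u \<Longrightarrow> u \<in> part v"
  using H_sym by (auto simp: part_def side_def)

lemma part_eq:
  assumes "u \<in> V" "v \<in> part u"
  shows "part v = part u"
proof -
  have *: "part b \<subseteq> part a" if "a \<in> V" "b \<in> part a" for a b
  proof
    fix w assume "w \<in> part b"
    then show "w \<in> part a"
      using that H_trans[of a w b] H_sym[of b a] by (auto simp: part_def side_def)
  qed
  have "v \<in> V" using assms by (auto simp: part_def side_def)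
  then show ?thesis using *[OF assms] *[of v u] part_sym[OF assms] by blast
qed

lemma neighbours: "{w \<in> V. H u w} = side u - part u"
  using H_side by (auto simp: part_def side_def)

lemma part_disjoint: "H u v \<Longrightarrow> part u \<inter> part v = {}"
  using H_trans[of u v] H_sym by (fastforce simp: part_def side_def)

lemma card_V: "S u \<noteq> S v \<Longrightarrow> card V = card (side u) + card (side v)"
proof -
  assume "S u \<noteq> S v"
  then have "V = side u \<union> side v" "side u \<inter> side v = {}" by (auto simp: side_def)
  then show ?thesis by (metis card_Un_disjoint finite_side)
qed

end

section \<open>Entries of \<open>M\<close> in terms of part sizes\<close>

locale two_multipartite_spectral = two_multipartite V H S + spectral_decomposition V D n e F
  for V :: "'a set" and H S D n e F +
  assumes D_H: "u \<in> V \<Longrightarrow> v \<in> V \<Longrightarrow> D u v = of_bool (u \<noteq> v) + of_bool (H u v)"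
begin

text \<open>Since \<open>D u w\<close> is \<open>1 + of_bool (H u w)\<close> for \<open>w\<close>
  different from \<open>u\<close>, the square of \<open>D\<close> counts the degrees and the common
  neighbours in \<open>H\<close>.\<close>

lemma M_count:
  assumes uv: "u \<in> V" "v \<in> V"
  shows "M u v = real (card V) + real (card (side u - part u)) + real (card (side v - part v))
    + real (card ((side u - part u) \<inter> (side v - part v))) + 2 + 2 * of_bool (H u v)"
proof -
  have delta: "(\<Sum>w\<in>V. of_bool (a = w) * f w) = f a" if "a \<in> V" for a and f :: "'a \<Rightarrow> real"
    using that finite_V by (simp add: of_bool_def if_distrib[of "\<lambda>x. x * _"] cong: if_cong)
  \<comment> \<open>The subtracted terms cancel the contributions of \<open>w = u\<close> and
    \<open>w = v\<close>, where a factor is 0; the last term repairs the double subtraction when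
    \<open>u = v\<close>.\<close>
  have "(\<Sum>w\<in>V. D u w * D w v) = (\<Sum>w\<in>V. 1 + of_bool (H u w) + of_bool (H w v) + of_bool (H u w \<and> H w v)
      - of_bool (u = w) * (1 + of_bool (H w v)) - of_bool (v = w) * (1 + of_bool (H u w))
      + of_bool (u = w) * of_bool (v = w))"
    by (intro sum.cong refl) (use uv in \<open>auto simp: D_H\<close>)
  also have "\<dots> = real (card V) + real (card (V \<inter> {w. H u w})) + real (card (V \<inter> {w. H w v}))
      + real (card (V \<inter> {w. H u w \<and> H w v}))
      - (1 + of_bool (H u v)) - (1 + of_bool (H u v)) + of_bool (v = u)"
    unfolding sum.distrib sum_subtractf delta[OF uv(1)] delta[OF uv(2)]
    using finite_V by (simp add: sum_of_bool_eq del: of_bool_conj)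
  finally have "M u v = real (card V) + real (card (V \<inter> {w. H u w})) + real (card (V \<inter> {w. H w v}))
      + real (card (V \<inter> {w. H u w \<and> H w v}))
      + 2 + 2 * of_bool (H u v)"
    using uv H_irrefl by (auto simp: M_def D_H)
  moreover have "V \<inter> {w. H u w} = side u - part u" "V \<inter> {w. H w v} = side v - part v"
    "V \<inter> {w. H u w \<and> H w v} = (side u - part u) \<inter> (side v - part v)"
    using neighbours[of u] neighbours[of v] H_sym by blast+
  ultimately show ?thesis by simp
qed

lemma card_side_minus_part: "real (card (side u - part u)) = real (card (side u)) - real (card (part u))"
  by (simp add: card_Diff_subset part_subset card_part_le of_nat_diff)

text \<open>Vertices of one part have the same neighbours in \<open>H\<close>. The case
  \<open>v = u\<close> gives the diagonal of \<open>M\<close>.\<close>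

lemma M_part:
  assumes "u \<in> V" "v \<in> part u"
  shows "M u v = card V + 3 * (real (card (side u)) - real (card (part u))) + 2"
proof -
  have v: "v \<in> V" "side v = side u" "\<not> H u v" using assms by (auto simp: part_def side_def)
  then show ?thesis
    using M_count[OF assms(1) v(1)] part_eq[OF assms] by (simp add: card_side_minus_part)
qed

text \<open>The common neighbours of adjacent vertices are the vertices of their side outside their
  two parts, and these parts are disjoint.\<close>

lemma M_adjacent:
  assumes "H u v"
  shows "M u v = card V + 3 * real (card (side u)) - 2 * real (card (part u)) - 2 * real (card (part v)) + 4"
proof -
  have side: "side v = side u" using H_side[OF assms] by (simp add: side_def)
  have *: "(side u - part u) \<inter> (side v - part v) = side u - (part u \<union> part v)" using side by auto
  have sub: "part u \<union> part v \<subseteq> side u" using part_subset[of u] part_subset[of v] side by simp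
  have "card (part u \<union> part v) = card (part u) + card (part v)"
    using part_disjoint[OF assms] by (simp add: card_Un_disjoint)
  then have "real (card (side u - (part u \<union> part v))) = real (card (side u)) - real (card (part u)) - real (card (part v))"
    using card_mono[OF finite_side sub] card_Diff_subset[OF _ sub] by (simp add: of_nat_diff)
  then show ?thesis
    using M_count[OF H_V[OF assms] H_V2[OF assms]] assms side *
      card_side_minus_part[of v] by (simp add: card_side_minus_part)
qed

lemma M_across:
  assumes "u \<in> V" "v \<in> V" "S u \<noteq> S v"
  shows "M u v = card V + (real (card (side u)) - real (card (part u)))
    + (real (card (side v)) - real (card (part v))) + 2"
proof -
  have "(side u - part u) \<inter> (side v - part v) = {}" using assms by (auto simp: side_def)
  then show ?thesis
    using M_count[OF assms(1,2)] H_side[of u v] assms(3) by (auto simp: card_side_minus_part)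
qed

end

section \<open>Forbidden induced subgraphs of the complement\<close>

locale diameter_two_extremal = two_exceptional V D n e F k1 k2
  for V :: "'a set" and D n e F k1 k2 +
  fixes H :: "'a \<Rightarrow> 'a \<Rightarrow> bool"
  assumes H_V: "H u v \<Longrightarrow> u \<in> V"
    and H_irrefl: "\<not> H u u"
    and H_sym: "H u v \<Longrightarrow> H v u"
    and D_H: "u \<in> V \<Longrightarrow> v \<in> V \<Longrightarrow> D u v = of_bool (u \<noteq> v) + of_bool (H u v)"
    and common: "H u v \<Longrightarrow> \<exists>w\<in>V. \<not> H u w \<and> \<not> H v w"
begin

lemma H_V2: "H u v \<Longrightarrow> v \<in> V" using H_V H_sym by blast

text \<open>This is \<open>form1_nonpos\<close> for three vectors supported on the points
  \<open>p i\<close>, where \<open>D + I\<close> has the entries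
  \<open>1 + of_bool (H (p i) (p j))\<close>.\<close>

lemma points_nonpos:
  fixes a1 a2 a3 :: "nat \<Rightarrow> real" and p :: "nat \<Rightarrow> 'a" and m :: nat
  assumes "\<And>i. i < m \<Longrightarrow> p i \<in> V"
  obtains x y z where "x \<noteq> 0 \<or> y \<noteq> 0 \<or> z \<noteq> 0"
    "(\<Sum>i<m. \<Sum>j<m. (x * a1 i + y * a2 i + z * a3 i) * (x * a1 j + y * a2 j + z * a3 j)
      * (1 + of_bool (H (p i) (p j)))) \<le> 0"
proof -
  let ?K = "\<lambda>u v. D u v + of_bool (u = v)"
  let ?f = "\<lambda>(a :: nat \<Rightarrow> real) w. \<Sum>i<m. a i * of_bool (w = p i)"
  obtain x y z where xyz: "x \<noteq> 0 \<or> y \<noteq> 0 \<or> z \<noteq> 0"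
    and le: "form V ?K (\<lambda>u. x * ?f a1 u + y * ?f a2 u + z * ?f a3 u) \<le> 0"
    by (rule form1_nonpos[of "?f a1" "?f a2" "?f a3"])
  have eq: "(\<lambda>u. x * ?f a1 u + y * ?f a2 u + z * ?f a3 u) = ?f (\<lambda>i. x * a1 i + y * a2 i + z * a3 i)"
    by (simp only: sum_distrib_left sum.distrib distrib_right mult.assoc)
  have "form V ?K (\<lambda>u. x * ?f a1 u + y * ?f a2 u + z * ?f a3 u)
    = (\<Sum>i<m. \<Sum>j<m. (x * a1 i + y * a2 i + z * a3 i) * (x * a1 j + y * a2 j + z * a3 j) * ?K (p i) (p j))"
    unfolding eq by (rule form_points[OF finV assms])
  also have "\<dots> = (\<Sum>i<m. \<Sum>j<m. (x * a1 i + y * a2 i + z * a3 i) * (x * a1 j + y * a2 j + z * a3 j)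
      * (1 + of_bool (H (p i) (p j))))"
    by (intro sum.cong refl) (use assms in \<open>simp add: D_H\<close>)
  finally show ?thesis using that[OF xyz] le by simp
qed

text \<open>The six numbers are the entries of the Gram matrix, with respect to \<open>D + I\<close>, of three vectors
  supported on the given points. By Sylvester's criterion they would span a 3-space on which
  \<open>D + I\<close> is positive definite.\<close>

lemma forbidden:
  fixes a1 a2 a3 :: "nat \<Rightarrow> real" and p :: "nat \<Rightarrow> 'a" and m :: nat
  defines "g \<equiv> \<lambda>(a :: nat \<Rightarrow> real) (b :: nat \<Rightarrow> real). \<Sum>i<m. \<Sum>j<m. a i * b j * (1 + of_bool (H (p i) (p j)))"
  assumes "\<And>i. i < m \<Longrightarrow> p i \<in> V"
    and "g a1 a1 = A" "g a2 a2 = B" "g a3 a3 = C" "g a1 a2 = G" "g a1 a3 = K" "g a2 a3 = L"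
    and "A > 0" "A * B - G\<^sup>2 > 0"
    and "A * (B * C - L\<^sup>2) - G * (G * C - L * K) + K * (G * L - B * K) > 0"
  shows False
proof -
  obtain x y z where xyz: "x \<noteq> 0 \<or> y \<noteq> 0 \<or> z \<noteq> 0"
    and le: "g (\<lambda>i. x * a1 i + y * a2 i + z * a3 i) (\<lambda>i. x * a1 i + y * a2 i + z * a3 i) \<le> 0"
    unfolding g_def
    by (rule points_nonpos[where p = p and m = m and ?a1.0 = a1 and ?a2.0 = a2 and ?a3.0 = a3, OF assms(2)])
  have g_sym: "g a b = g b a" for a b
    unfolding g_def
    by (subst sum.swap) (use H_sym in \<open>auto intro!: sum.cong simp: of_bool_def\<close>)
  have g_lin: "g (\<lambda>i. x * a1 i + y * a2 i + z * a3 i) b = x * g a1 b + y * g a2 b + z * g a3 b" for b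
    by (simp only: g_def sum_distrib_left sum.distrib distrib_right mult.assoc)
  have g_lin': "g b (\<lambda>i. x * a1 i + y * a2 i + z * a3 i) = x * g a1 b + y * g a2 b + z * g a3 b" for b
    using g_lin[of b] g_sym by simp
  have "A * x\<^sup>2 + B * y\<^sup>2 + C * z\<^sup>2 + 2 * G * x * y + 2 * K * x * z + 2 * L * y * z \<le> 0"
    using le assms(3-8) g_sym[of a2 a1] g_sym[of a3 a1] g_sym[of a3 a2]
    unfolding g_lin unfolding g_lin' by (simp add: power2_eq_square algebra_simps)
  then show False using pos_def3[OF assms(9-11)] xyz by blast
qed

text \<open>The test vectors are the indicators of \<open>v5\<close> and of the two edges; their
  Gram matrix has the leading minors 1, 2 and 4.\<close>

lemma no_2K2_K1:
  assumes "H v1 v2" "H v3 v4"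
    "\<not> H v1 v3" "\<not> H v1 v4" "\<not> H v1 v5" "\<not> H v2 v3"
    "\<not> H v2 v4" "\<not> H v2 v5" "\<not> H v3 v5" "\<not> H v4 v5" "v5 \<in> V"
  shows False
proof -
  have "v1 \<in> V" "v2 \<in> V" "v3 \<in> V" "v4 \<in> V" "v5 \<in> V"
    using assms H_V H_V2 by blast+
  then have pts: "[v1, v2, v3, v4, v5] ! i \<in> V" if "i < 5" for i
    using that by (auto simp: eval_nat_numeral less_Suc_eq)
  have sym: "H v2 v1" "H v4 v3"
    "\<not> H v3 v1" "\<not> H v4 v1" "\<not> H v5 v1" "\<not> H v3 v2" "\<not> H v4 v2" "\<not> H v5 v2" "\<not> H v5 v3" "\<not> H v5 v4"
    using assms H_sym by blast+
  show ?thesis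
    by (rule forbidden[where m = 5 and p = "(!) [v1, v2, v3, v4, v5]"
            and ?a1.0 = "(!) [0, 0, 0, 0, 1]" and ?a2.0 = "(!) [0, 0, 1, 1, 0]" and ?a3.0 = "(!) [1, 1, 0, 0, 0]"
            and A = 1 and B = 6 and C = 6 and G = 2 and K = "2" and L = "4"])
      (use pts sym assms H_irrefl in \<open>simp_all add: eval_nat_numeral lessThan_Suc\<close>)
qed

text \<open>The vectors of \<open>no_2K2_K1\<close> serve again. The middle edge of the path raises
  \<open>L\<close> to 5, and the leading minors are 1, 2 and 3.\<close>

lemma no_P4_K1:
  assumes "H v1 v2" "H v2 v3" "H v3 v4"
    "\<not> H v1 v3" "\<not> H v1 v4" "\<not> H v1 v5" "\<not> H v2 v4"
    "\<not> H v2 v5" "\<not> H v3 v5" "\<not> H v4 v5" "v5 \<in> V"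
  shows False
proof -
  have "v1 \<in> V" "v2 \<in> V" "v3 \<in> V" "v4 \<in> V" "v5 \<in> V"
    using assms H_V H_V2 by blast+
  then have pts: "[v1, v2, v3, v4, v5] ! i \<in> V" if "i < 5" for i
    using that by (auto simp: eval_nat_numeral less_Suc_eq)
  have sym: "H v2 v1" "H v3 v2" "H v4 v3"
    "\<not> H v3 v1" "\<not> H v4 v1" "\<not> H v5 v1" "\<not> H v4 v2" "\<not> H v5 v2" "\<not> H v5 v3" "\<not> H v5 v4"
    using assms H_sym by blast+
  show ?thesis
    by (rule forbidden[where m = 5 and p = "(!) [v1, v2, v3, v4, v5]"
            and ?a1.0 = "(!) [0, 0, 0, 0, 1]" and ?a2.0 = "(!) [0, 0, 1, 1, 0]" and ?a3.0 = "(!) [1, 1, 0, 0, 0]"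
            and A = 1 and B = 6 and C = 6 and G = 2 and K = "2" and L = "5"])
      (use pts sym assms H_irrefl in \<open>simp_all add: eval_nat_numeral lessThan_Suc\<close>)
qed

text \<open>The pendant vertex \<open>v1\<close> gets the weight 2, because with weight 1 the Gram
  determinant would be 0. The leading minors are 1, 2 and 4.\<close>

lemma no_paw_K1:
  assumes "H v1 v2" "H v2 v3" "H v2 v4" "H v3 v4"
    "\<not> H v1 v3" "\<not> H v1 v4" "\<not> H v1 v5" "\<not> H v2 v5"
    "\<not> H v3 v5" "\<not> H v4 v5" "v5 \<in> V"
  shows False
proof -
  have "v1 \<in> V" "v2 \<in> V" "v3 \<in> V" "v4 \<in> V" "v5 \<in> V"
    using assms H_V H_V2 by blast+
  then have pts: "[v1, v2, v3, v4, v5] ! i \<in> V" if "i < 5" for i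
    using that by (auto simp: eval_nat_numeral less_Suc_eq)
  have sym: "H v2 v1" "H v3 v2" "H v4 v2" "H v4 v3"
    "\<not> H v3 v1" "\<not> H v4 v1" "\<not> H v5 v1" "\<not> H v5 v2" "\<not> H v5 v3" "\<not> H v5 v4"
    using assms H_sym by blast+
  show ?thesis
    by (rule forbidden[where m = 5 and p = "(!) [v1, v2, v3, v4, v5]"
            and ?a1.0 = "(!) [0, 0, 0, 0, 1]" and ?a2.0 = "(!) [0, 0, 1, 1, 0]" and ?a3.0 = "(!) [2, 1, 0, 0, 0]"
            and A = 1 and B = 6 and C = 13 and G = 2 and K = "3" and L = "8"])
      (use pts sym assms H_irrefl in \<open>simp_all add: eval_nat_numeral lessThan_Suc\<close>)
qed

text \<open>The indicators of \<open>v5\<close> and of the edge from \<open>v2\<close> to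
  \<open>v3\<close> are combined with a signed vector on \<open>v1\<close>, \<open>v3\<close> and
  \<open>v4\<close>. The leading minors are 1, 2 and 3.\<close>

lemma no_C5:
  assumes "H v1 v2" "H v2 v3" "H v3 v4" "H v4 v5" "H v1 v5"
    "\<not> H v1 v3" "\<not> H v1 v4" "\<not> H v2 v4" "\<not> H v2 v5"
    "\<not> H v3 v5"
  shows False
proof -
  have "v1 \<in> V" "v2 \<in> V" "v3 \<in> V" "v4 \<in> V" "v5 \<in> V"
    using assms H_V H_V2 by blast+
  then have pts: "[v1, v2, v3, v4, v5] ! i \<in> V" if "i < 5" for i
    using that by (auto simp: eval_nat_numeral less_Suc_eq)
  have sym: "H v2 v1" "H v3 v2" "H v4 v3" "H v5 v4" "H v5 v1"
    "\<not> H v3 v1" "\<not> H v4 v1" "\<not> H v4 v2" "\<not> H v5 v2" "\<not> H v5 v3"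
    using assms H_sym by blast+
  show ?thesis
    by (rule forbidden[where m = 5 and p = "(!) [v1, v2, v3, v4, v5]"
            and ?a1.0 = "(!) [0, 0, 0, 0, 1]" and ?a2.0 = "(!) [0, 1, 1, 0, 0]" and ?a3.0 = "(!) [1, 0, -1, -1, 0]"
            and A = 1 and B = 6 and C = 3 and G = 2 and K = "(-1)" and L = "(-3)"])
      (use pts sym assms H_irrefl in \<open>simp_all add: eval_nat_numeral lessThan_Suc\<close>)
qed

text \<open>Compared with \<open>no_C5\<close>, the first vector is the indicator of the end edge
  from \<open>v4\<close> to \<open>v5\<close>. The leading minors are 6, 11 and 3.\<close>

lemma no_P5:
  assumes "H v1 v2" "H v2 v3" "H v3 v4" "H v4 v5"
    "\<not> H v1 v3" "\<not> H v1 v4" "\<not> H v1 v5" "\<not> H v2 v4"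
    "\<not> H v2 v5" "\<not> H v3 v5"
  shows False
proof -
  have "v1 \<in> V" "v2 \<in> V" "v3 \<in> V" "v4 \<in> V" "v5 \<in> V"
    using assms H_V H_V2 by blast+
  then have pts: "[v1, v2, v3, v4, v5] ! i \<in> V" if "i < 5" for i
    using that by (auto simp: eval_nat_numeral less_Suc_eq)
  have sym: "H v2 v1" "H v3 v2" "H v4 v3" "H v5 v4"
    "\<not> H v3 v1" "\<not> H v4 v1" "\<not> H v5 v1" "\<not> H v4 v2" "\<not> H v5 v2" "\<not> H v5 v3"
    using assms H_sym by blast+
  show ?thesis
    by (rule forbidden[where m = 5 and p = "(!) [v1, v2, v3, v4, v5]"
            and ?a1.0 = "(!) [0, 0, 0, 1, 1]" and ?a2.0 = "(!) [0, 1, 1, 0, 0]" and ?a3.0 = "(!) [1, 0, -1, -1, 0]"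
            and A = 6 and B = 6 and C = 3 and G = 5 and K = "(-4)" and L = "(-3)"])
      (use pts sym assms H_irrefl in \<open>simp_all add: eval_nat_numeral lessThan_Suc\<close>)
qed

end

context two_multipartite
begin

text \<open>A nonadjacent pair \<open>a\<close>, \<open>b\<close> would lie in one class, so that
  the disjoint parts of \<open>u\<close> and \<open>v\<close> would coincide.\<close>

lemma adjacent_parts:
  assumes "H u v" "a \<in> part u" "b \<in> part v"
  shows "H a b"
proof (rule ccontr)
  assume "\<not> H a b"
  have uv: "u \<in> V" "v \<in> V" "S v = S u" using assms H_V H_V2 H_side by blast+
  have ab: "a \<in> V" "b \<in> V" "S a = S u" "S b = S u" using assms uv by (auto simp: part_def side_def)
  then have "b \<in> part a" using \<open>\<not> H a b\<close> by (auto simp: part_def side_def)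
  then have "part u = part v" using part_eq ab uv assms by metis
  then show False using part_disjoint[OF assms(1)] self_in_part[OF uv(1)] by blast
qed

end

context diameter_two_extremal
begin

text \<open>Let \<open>z\<close> be adjacent in \<open>H\<close> to neither end of the middle edge.
  According to its adjacency to \<open>v1\<close> and \<open>v4\<close>, the five vertices induce P4
  + K1, P5 (in two ways) or C5.\<close>

lemma no_P4:
  assumes "H v1 v2" "H v2 v3" "H v3 v4" "\<not> H v1 v3" "\<not> H v1 v4" "\<not> H v2 v4"
  shows False
proof -
  obtain z where z: "z \<in> V" "\<not> H v2 z" "\<not> H v3 z" using common[OF assms(2)] by blast
  have z': "\<not> H z v2" "\<not> H z v3" "H z v1 = H v1 z" "H z v4 = H v4 z" using z H_sym by blast+
  show False
    using no_P4_K1[of v1 v2 v3 v4 z] no_P5[of z v1 v2 v3 v4] no_P5[of v1 v2 v3 v4 z]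
      no_C5[of v1 v2 v3 v4 z] assms z z' by blast
qed

text \<open>This says that no edge leaves the set of vertices adjacent to an end of a given edge, so
  an edge dominates its component. If \<open>x\<close> is adjacent to only one end, there is an
  induced P4; if to both, a triangle with pendant vertex \<open>y\<close>.\<close>

lemma separated:
  assumes "H u v" "\<not> H y u" "\<not> H y v" "H x y" "H x u \<or> H x v"
  shows False
proof -
  have *: False if h: "H u v" "\<not> H y u" "\<not> H y v" "H x u" for u v
  proof (cases "H x v")
    case False
    then show False using no_P4[of y x u v] h assms(4) H_sym by blast
  next
    case True
    \<comment> \<open>If \<open>z\<close> is adjacent to \<open>y\<close> or to \<open>v\<close>, an
      induced P4 arises; otherwise \<open>z\<close> is an isolated vertex beside the paw on
      \<open>y\<close>, \<open>x\<close>, \<open>u\<close>, \<open>v\<close>.\<close>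
    obtain z where z: "z \<in> V" "\<not> H x z" "\<not> H u z" using common[OF h(4)] by blast
    have adj: "H y x" "H u x" "H v x" using True h assms(4) H_sym by blast+
    have nadj: "\<not> H u y" "\<not> H v y" "\<not> H z x" "\<not> H z u" using z h H_sym by blast+
    show False
    proof (cases "H z y")
      case zy: True
      show False
      proof (cases "H z v")
        case True
        then show False using no_P4[of u x y z] adj nadj assms(4) z H_sym[OF zy] by blast
      next
        case False
        then show False using no_P4[of z y x u] zy adj nadj h by blast
      qed
    next
      case zy: False
      show False
      proof (cases "H z v")
        case True
        then show False using no_P4[of z v x y] zy adj nadj assms(4) by blast
      next
        case False
        then have "\<not> H v z" "\<not> H y z" using zy H_sym by blast+
        then show False using no_paw_K1[of y x u v z] adj h z \<open>H x v\<close> by blast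
      qed
    qed
  qed
  show False using *[of u v] *[of v u] assms H_sym by blast
qed

text \<open>One side is the component of the given edge, that is, the vertices adjacent to
  \<open>u0\<close> or \<open>v0\<close>; a vertex provided by \<open>common\<close> lies on the
  other side.\<close>

lemma two_multipartite_if_edge:
  assumes uv0: "H u0 v0"
  obtains S where "two_multipartite V H S" "S u0" "\<exists>y\<in>V. \<not> S y"
proof
  let ?S = "\<lambda>w. H w u0 \<or> H w v0"
  have side: "?S x = ?S y" if "H x y" for x y
    using separated[OF uv0, of x y] separated[OF uv0, of y x] that H_sym[OF that] by blast
  have trans: "H w u \<or> H w v" if uv: "H u v" and w: "w \<in> V" "?S w = ?S u" for u v w
  proof (rule ccontr)
    assume no: "\<not> (H w u \<or> H w v)"
    show False
    proof (cases "?S u")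
      case True
      \<comment> \<open>Here \<open>t\<close> is an end of the given edge that is adjacent to
        \<open>w\<close>. If \<open>t\<close> is adjacent to \<open>u\<close> or \<open>v\<close>,
        then \<open>w\<close> violates \<open>separated\<close> for the edge from \<open>u\<close>
        to \<open>v\<close>; otherwise \<open>t\<close> does, through its neighbour
        \<open>t'\<close>.\<close>
      have *: False if "H t t'" "H w t" "H u t \<or> H u t'" for t t'
      proof (cases "H t u \<or> H t v")
        case True
        then show False using separated[OF uv, of w t] no that H_sym by blast
      next
        case False
        then show False using separated[OF uv, of t t'] that H_sym by blast
      qed
      show False using *[of u0 v0] *[of v0 u0] uv0 H_sym[OF uv0] True w by blast
    next
      case False
      then have "\<not> ?S v" "\<not> ?S w" using side[OF uv] w by blast+
      \<comment> \<open>Off the component of the given edge, the two edges and \<open>w\<close>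
        induce 2 K2 + K1.\<close>
      then show False using no_2K2_K1[of u0 v0 u v w] uv0 uv no w False H_sym by blast
    qed
  qed
  show "two_multipartite V H ?S"
    using finV H_V H_irrefl H_sym side trans by unfold_locales
  show "?S u0" using uv0 by blast
  show "\<exists>y\<in>V. \<not> ?S y" using common[OF uv0] H_sym by blast
qed

end

section \<open>The shapes of the two sides\<close>

locale extremal_sides = two_multipartite_spectral V H S D n e F + diameter_two_extremal V D n e F k1 k2 H
  for V :: "'a set" and H S D n e F k1 k2
begin

text \<open>The weights -3 on two vertices of one part and 2 on three vertices of the other give the
  form of \<open>D + 3 I\<close> the value -12.\<close>

lemma no_K23:
  assumes "H u v" "card (part u) \<ge> 2" "card (part v) \<ge> 3"
  shows False
proof -
  obtain U where "U \<subseteq> part u" "card U = 2" using obtain_subset_with_card_n[OF assms(2)] by blast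
  then obtain u1 u2 where u12: "u1 \<in> part u" "u2 \<in> part u" "u1 \<noteq> u2" by (auto simp: card_2_iff)
  obtain W where "W \<subseteq> part v" "card W = 3" using obtain_subset_with_card_n[OF assms(3)] by blast
  then obtain v1 v2 v3 where v123: "v1 \<in> part v" "v2 \<in> part v" "v3 \<in> part v"
    "v1 \<noteq> v2" "v1 \<noteq> v3" "v2 \<noteq> v3" by (auto simp: card_3_iff)
  have uv: "u \<in> V" "v \<in> V" using H_V H_V2 assms by blast+
  have V: "u1 \<in> V" "u2 \<in> V" "v1 \<in> V" "v2 \<in> V" "v3 \<in> V"
    using u12 v123 by (auto simp: part_def side_def)
  have adj: "H a b" "H b a" if "a \<in> part u" "b \<in> part v" for a b
    using adjacent_parts[OF assms(1) that] H_sym by blast+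
  have nadj: "\<not> H a b" if "a \<in> part w" "b \<in> part w" "w \<in> V" for a b w
    using part_eq[OF that(3,1)] that(2) by (auto simp: part_def)
  have dist: "u1 \<noteq> v1" "u1 \<noteq> v2" "u1 \<noteq> v3" "u2 \<noteq> v1" "u2 \<noteq> v2" "u2 \<noteq> v3"
    using part_disjoint[OF assms(1)] u12 v123 by blast+
  let ?p = "(!) [u1, u2, v1, v2, v3]" and ?a = "(!) [-3, -3, 2, 2, 2 :: real]"
  define K where "K = (\<lambda>u v. D u v + 3 * of_bool (u = v))"
  have pts: "?p i \<in> V" if "i < 5" for i
    using that V by (auto simp: eval_nat_numeral less_Suc_eq)
  have "0 \<le> form V K (\<lambda>w. \<Sum>i<5. ?a i * of_bool (w = ?p i))"
    unfolding K_def by (rule form3_nonneg)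
  also have "\<dots> = (\<Sum>i<5. \<Sum>j<5. ?a i * ?a j * K (?p i) (?p j))"
    by (rule form_points[OF finV pts])
  also have "\<dots> = - 12"
  proof -
    have "K a b = 1" if "a \<in> part w" "b \<in> part w" "a \<noteq> b" "w \<in> V" for a b w
      using D_H[of a b] nadj[OF that(1,2,4)] that by (auto simp: K_def part_def side_def)
    then have 1: "K u1 u2 = 1" "K u2 u1 = 1" "K v1 v2 = 1" "K v2 v1 = 1" "K v1 v3 = 1" "K v3 v1 = 1"
      "K v2 v3 = 1" "K v3 v2 = 1"
      using u12 v123 uv by metis+
    have "K a b = 2 \<and> K b a = 2" if "a \<in> part u" "b \<in> part v" "a \<noteq> b" for a b
      using D_H[of a b] D_H[of b a] adj[OF that(1,2)] that by (auto simp: K_def part_def side_def)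
    then have 2: "K u1 v1 = 2" "K v1 u1 = 2" "K u1 v2 = 2" "K v2 u1 = 2" "K u1 v3 = 2" "K v3 u1 = 2"
      "K u2 v1 = 2" "K v1 u2 = 2" "K u2 v2 = 2" "K v2 u2 = 2" "K u2 v3 = 2" "K v3 u2 = 2"
      using u12 v123 dist by blast+
    have "K a a = 3" if "a \<in> V" for a using D_H[OF that that] H_irrefl by (simp add: K_def)
    then have 3: "K u1 u1 = 3" "K u2 u2 = 3" "K v1 v1 = 3" "K v2 v2 = 3" "K v3 v3 = 3"
      using V by blast+
    have "(\<Sum>i<5. f i) = f 0 + f 1 + f 2 + f 3 + f 4" for f :: "nat \<Rightarrow> real"
      by (simp add: eval_nat_numeral lessThan_Suc)
    then show ?thesis by (simp add: 1 2 3)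
  qed
  finally show False by simp
qed

text \<open>A squared distance is nonnegative, so the sizes have sum at least 4. If the sum is 4,
  the two points coincide, and equal diagonal entries of \<open>M\<close> mean equal sizes. For a
  larger sum, \<open>no_K23\<close> leaves one part of size 1.\<close>

lemma edge_sizes:
  assumes "H u v"
  shows "card (part u) = 2 \<and> card (part v) = 2 \<or> card (part u) = 1 \<and> card (part v) \<ge> 4
    \<or> card (part v) = 1 \<and> card (part u) \<ge> 4"
proof -
  have uv: "u \<in> V" "v \<in> V" "side v = side u" using H_V H_V2 H_side assms by (auto simp: side_def)
  let ?a = "card (part u)" and ?b = "card (part v)"
  obtain f g where M: "\<And>u v. u \<in> V \<Longrightarrow> v \<in> V \<Longrightarrow> M u v = f u * f v + g u * g v"
    using M_plane by blast
  have "(f u - f v)\<^sup>2 + (g u - g v)\<^sup>2 = M u u + M v v - 2 * M u v"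
    using uv by (simp add: M power2_eq_square algebra_simps)
  also have "\<dots> = real ?a + real ?b - 4"
    using M_part[OF uv(1) self_in_part[OF uv(1)]] M_part[OF uv(2) self_in_part[OF uv(2)]]
      M_adjacent[OF assms] uv(3) by simp
  finally have *: "(f u - f v)\<^sup>2 + (g u - g v)\<^sup>2 = real ?a + real ?b - 4" .
  moreover have "0 \<le> (f u - f v)\<^sup>2 + (g u - g v)\<^sup>2" by simp
  ultimately have ge: "?a + ?b \<ge> 4" by linarith
  have eq: "?a = ?b" if "?a + ?b = 4"
  proof -
    have "real ?a + real ?b = 4" using that by linarith
    then have "f u = f v" "g u = g v" using * by (simp_all add: sum_power2_eq_zero_iff)
    then have "M u u = M v v" using uv by (simp add: M)
    then show ?thesis
      using M_part[OF uv(1) self_in_part[OF uv(1)]] M_part[OF uv(2) self_in_part[OF uv(2)]] uv(3) by simp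
  qed
  have "?a \<ge> 1" "?b \<ge> 1" using card_part_pos uv by (simp_all add: Suc_le_eq)
  moreover have "\<not> (?a \<ge> 2 \<and> ?b \<ge> 3)" "\<not> (?b \<ge> 2 \<and> ?a \<ge> 3)"
    using no_K23[OF assms] no_K23[OF H_sym[OF assms]] by blast+
  ultimately show ?thesis using ge eq by linarith
qed

text \<open>The left-hand side is the Gram determinant of the points of the centre \<open>c0\<close>, a leaf \<open>v\<close> and \<open>y\<close>.\<close>

lemma star_opposite:
  assumes cv: "H c0 v" and star: "card (part c0) = 1" "side c0 = insert c0 (part v)"
    and y: "y \<in> V" "S y \<noteq> S c0"
  defines "b \<equiv> real (card (part v))" and "t \<equiv> real (card (part y))"
    and "d \<equiv> real (card (side y)) - real (card (part y))"
  shows "t * ((b - 3) * d + b - 4) + d * (6 * b - 34) + 2 * b - 12 = 0"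
proof -
  have V: "c0 \<in> V" "v \<in> V" and Sv: "S v = S c0" using cv H_V H_V2 H_side by blast+
  have side: "side v = side c0" using Sv by (simp add: side_def)
  have "c0 \<notin> part v" using cv H_sym by (auto simp: part_def)
  then have sc: "real (card (side c0)) = b + 1" by (simp add: star(2) b_def)
  have sy: "real (card (side y)) = t + d" by (simp add: t_def d_def)
  have cV: "real (card V) = b + 1 + (t + d)" using card_V[of c0 y] y sc sy by simp
  obtain f g where M: "\<And>u v. u \<in> V \<Longrightarrow> v \<in> V \<Longrightarrow> M u v = f u * f v + g u * g v"
    using M_plane by blast
  have vals: "M v v = b + 1 + (t + d) + 3 * 1 + 2" "M c0 c0 = b + 1 + (t + d) + 3 * b + 2"
    "M y y = b + 1 + (t + d) + 3 * d + 2"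
    using M_part[OF V(1) self_in_part[OF V(1)]] M_part[OF V(2) self_in_part[OF V(2)]]
      M_part[OF y(1) self_in_part[OF y(1)]] sc sy cV star(1) side
    by (simp_all add: b_def[symmetric] t_def[symmetric])
  have vals2: "M v c0 = b + 1 + (t + d) + 3 * (b + 1) - 2 * b - 2 + 4" "M v y = b + 1 + (t + d) + 1 + d + 2"
    "M c0 y = b + 1 + (t + d) + b + d + 2"
    using M_adjacent[OF H_sym[OF cv]] M_across[OF V(2) y(1)] M_across[OF V(1) y(1)] sc sy cV star(1) side Sv y(2)
    by (simp_all add: b_def[symmetric] t_def[symmetric])
  have "M v v * (M c0 c0 * M y y - (M c0 y)\<^sup>2) - M v c0 * (M v c0 * M y y - M c0 y * M v y)
    + M v y * (M v c0 * M c0 y - M c0 c0 * M v y) = 0"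
    by (rule plane_gram_det[where f = f and g = g]) (use M V y in auto)
  then show ?thesis unfolding vals vals2 by (simp add: power2_eq_square algebra_simps)
qed

text \<open>For star size b the relation of \<open>star_opposite\<close> fails by sign if b is at
  least 6, becomes \<open>d * (t - 10) = 4\<close> if b is 4, and factors as
  \<open>(t - 2) * (2 * d + 1) = 0\<close> if b is 5. The case b = 4 is excluded by
  \<open>small\<close>, which yields an opposite vertex with d = 0 or t at most 2.\<close>

lemma star_opposite_sizes:
  assumes cv: "H c0 v" and star: "card (part c0) = 1" "side c0 = insert c0 (part v)"
    and ge: "card (part v) \<ge> 4"
    and opp: "\<exists>y\<in>V. S y \<noteq> S c0"
    and small: "\<And>y. y \<in> V \<Longrightarrow> S y \<noteq> S c0 \<Longrightarrow>
      card (side y) = card (part y) \<or> (\<exists>y'\<in>V. S y' \<noteq> S c0 \<and> card (part y') \<le> 2)"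
  shows "card (part v) = 5" "\<And>y. y \<in> V \<Longrightarrow> S y \<noteq> S c0 \<Longrightarrow> card (part y) = 2"
proof -
  let ?b = "real (card (part v))"
  have eq: "real (card (part y)) * ((?b - 3) * (real (card (side y)) - real (card (part y))) + ?b - 4)
      + (real (card (side y)) - real (card (part y))) * (6 * ?b - 34) + 2 * ?b - 12 = 0"
    if "y \<in> V" "S y \<noteq> S c0" for y
    using star_opposite[OF cv star that] .
  obtain y where y: "y \<in> V" "S y \<noteq> S c0" using opp by blast
  have nonneg: "real (card (side y)) - real (card (part y)) \<ge> 0" for y
    using card_part_le[of y] by simp
  have pos: "real (card (part y)) \<ge> 1" if "y \<in> V" for y
    using card_part_pos[OF that] by simp
  show b5: "card (part v) = 5"
  proof (rule ccontr)
    assume "card (part v) \<noteq> 5"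
    then consider "card (part v) = 4" | "card (part v) \<ge> 6" using ge by linarith
    then show False
    proof cases
      case 2
      then have b6: "?b \<ge> 6" by simp
      let ?d = "real (card (side y)) - real (card (part y))"
      have "(?b - 3) * ?d \<ge> 0" "?d * (6 * ?b - 34) \<ge> 0" using nonneg b6 by simp_all
      moreover then have "real (card (part y)) * ((?b - 3) * ?d + ?b - 4) > 0"
        using pos[OF y(1)] b6 by (intro mult_pos_pos) auto
      ultimately show False using eq[OF y] b6 by linarith
    next
      case 1
      have e4: "(real (card (side y)) - real (card (part y))) * (real (card (part y)) - 10) = 4"
        if "y \<in> V" "S y \<noteq> S c0" for y
        using eq[OF that] 1 by (simp add: algebra_simps)
      from small[OF y] show False
      proof
        assume "card (side y) = card (part y)"
        then show False using e4[OF y] by simp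
      next
        assume "\<exists>y'\<in>V. S y' \<noteq> S c0 \<and> card (part y') \<le> 2"
        then obtain y' where y': "y' \<in> V" "S y' \<noteq> S c0" "card (part y') \<le> 2" by blast
        have "(real (card (side y')) - real (card (part y'))) * (real (card (part y')) - 10) \<le> 0"
          using nonneg y'(3) by (intro mult_nonneg_nonpos) auto
        then show False using e4[OF y'(1,2)] by simp
      qed
    qed
  qed
  show "card (part y) = 2" if "y \<in> V" "S y \<noteq> S c0" for y
  proof -
    let ?t = "real (card (part y))" and ?d = "real (card (side y)) - real (card (part y))"
    have "(?t - 2) * (2 * ?d + 1) = 0"
      using eq[OF that] b5 by (simp add: algebra_simps)
    moreover have "2 * ?d + 1 > 0" using nonneg[of y] by argo
    ultimately have "?t = 2" by simp
    then show ?thesis by simp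
  qed
qed

text \<open>If the side has an edge, \<open>edge_sizes\<close> describes its two parts. Every vertex
  of the side is adjacent to one of the ends, so the sizes propagate to the whole side.\<close>

lemma side_cases:
  assumes u: "u \<in> V"
  obtains (independent) "\<And>w. w \<in> side u \<Longrightarrow> side u = part w"
  | (paired) "\<And>w. w \<in> side u \<Longrightarrow> card (part w) = 2"
  | (star) c0 v where "H c0 v" "S c0 = S u" "card (part c0) = 1" "card (part v) \<ge> 4" "side c0 = insert c0 (part v)"
proof (cases "\<exists>x y. H x y \<and> S x = S u")
  case False
  have "side u = part w" if "w \<in> side u" for w
    using False that by (auto simp: part_def side_def)
  then show ?thesis using independent by blast
next
  case True
  then obtain x y where xy: "H x y" "S x = S u" by blast
  have Sy: "S y = S u" using H_side[OF xy(1)] xy(2) by simp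
  have w: "H w x \<or> H w y" if "w \<in> side u" for w
    using H_trans[OF xy(1), of w] that xy(2) by (auto simp: side_def)
  \<comment> \<open>A further vertex \<open>z\<close> would be adjacent to both \<open>c0\<close>
    and \<open>v\<close>: the edge to \<open>v\<close> forces its part to have size 1, the edge to
    \<open>c0\<close> size at least 4.\<close>
  have st: thesis if h: "H c0 v" "S c0 = S u" "card (part c0) = 1" "card (part v) \<ge> 4" for c0 v
  proof -
    have V: "c0 \<in> V" "v \<in> V" "S v = S u" using h H_V H_V2 H_side by blast+
    have "side c0 \<subseteq> insert c0 (part v)"
    proof
      fix z assume z: "z \<in> side c0"
      show "z \<in> insert c0 (part v)"
      proof (rule ccontr)
        assume no: "z \<notin> insert c0 (part v)"
        then have "H v z" using z V h by (auto simp: part_def side_def)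
        moreover have "part c0 = {c0}"
          using h(3) self_in_part[OF V(1)] by (metis card_1_singletonE singletonD)
        then have "H c0 z" using z no V h(2) by (auto simp: part_def side_def)
        ultimately show False
          using edge_sizes[of v z] edge_sizes[of c0 z] h(3,4) by linarith
      qed
    qed
    moreover have "insert c0 (part v) \<subseteq> side c0" using V h(2) by (auto simp: part_def side_def)
    ultimately show thesis using star[OF h] by blast
  qed
  from edge_sizes[OF xy(1)] consider "card (part x) = 2" "card (part y) = 2"
    | "card (part x) = 1" "card (part y) \<ge> 4" | "card (part y) = 1" "card (part x) \<ge> 4" by blast
  then show ?thesis
  proof cases
    case 1
    have "card (part z) = 2" if "z \<in> side u" for z
      using w[OF that] edge_sizes[of z x] edge_sizes[of z y] 1 by auto
    then show ?thesis using paired by blast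
  next
    case 2
    then show ?thesis using st[OF xy] by blast
  next
    case 3
    then show ?thesis using st[OF H_sym[OF xy(1)] Sy] by blast
  qed
qed

end

section \<open>Isomorphisms with the extremal graphs\<close>

text \<open>The graph on \<open>Z\<close> in which the pairs related by \<open>H\<close> are the nonedges is isomorphic to \<open>K\<close>.\<close>

definition co_iso :: "('a \<Rightarrow> 'a \<Rightarrow> bool) \<Rightarrow> 'a set \<Rightarrow> 'b pair_pre_digraph \<Rightarrow> bool" where
  "co_iso H Z K \<longleftrightarrow> (\<exists>f. bij_betw f Z (pverts K)
    \<and> (\<forall>u\<in>Z. \<forall>v\<in>Z. u \<noteq> v \<longrightarrow> ((f u, f v) \<in> parcs K \<longleftrightarrow> \<not> H u v)))"

lemma co_iso_join:
  assumes X: "co_iso H X K" and Y: "co_iso H Y L" and "X \<inter> Y = {}"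
    and H: "\<And>x y. x \<in> X \<Longrightarrow> y \<in> Y \<Longrightarrow> \<not> H x y \<and> \<not> H y x"
  shows "co_iso H (X \<union> Y) (graph_join K L)"
proof -
  obtain f where f: "bij_betw f X (pverts K)"
    "\<And>u v. u \<in> X \<Longrightarrow> v \<in> X \<Longrightarrow> u \<noteq> v \<Longrightarrow> (f u, f v) \<in> parcs K \<longleftrightarrow> \<not> H u v"
    using X unfolding co_iso_def by blast
  obtain g where g: "bij_betw g Y (pverts L)"
    "\<And>u v. u \<in> Y \<Longrightarrow> v \<in> Y \<Longrightarrow> u \<noteq> v \<Longrightarrow> (g u, g v) \<in> parcs L \<longleftrightarrow> \<not> H u v"
    using Y unfolding co_iso_def by blast
  define h where "h = (\<lambda>u. if u \<in> X then Inl (f u) else Inr (g u))"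
  have fV: "f u \<in> pverts K" if "u \<in> X" for u using f(1) that by (auto simp: bij_betw_def)
  have gV: "g u \<in> pverts L" if "u \<in> Y" for u using g(1) that by (auto simp: bij_betw_def)
  have hX: "h u = Inl (f u)" if "u \<in> X" for u using that by (simp add: h_def)
  have hY: "h u = Inr (g u)" if "u \<in> Y" for u using that assms(3) by (auto simp: h_def)
  have "inj_on h (X \<union> Y)"
  proof (rule inj_onI)
    fix u v assume uv: "u \<in> X \<union> Y" "v \<in> X \<union> Y" "h u = h v"
    have inj: "inj_on f X" "inj_on g Y" using f(1) g(1) by (simp_all add: bij_betw_def)
    from uv consider "u \<in> X" "v \<in> X" | "u \<in> Y" "v \<in> Y" | "u \<in> X" "v \<in> Y" | "u \<in> Y" "v \<in> X" by blast
    then show "u = v"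
    proof cases
      case 1
      then show ?thesis using uv(3) hX inj_onD[OF inj(1)] by simp
    next
      case 2
      then show ?thesis using uv(3) hY inj_onD[OF inj(2)] by simp
    qed (use uv(3) hX hY in simp_all)
  qed
  moreover have "h ` (X \<union> Y) = pverts (graph_join K L)"
  proof -
    have "h ` X = Inl ` pverts K" using f(1) by (force simp: hX bij_betw_def)
    moreover have "h ` Y = Inr ` pverts L" using g(1) by (force simp: hY bij_betw_def)
    ultimately show ?thesis by (simp add: image_Un graph_join_def Plus_def)
  qed
  moreover have "(h u, h v) \<in> parcs (graph_join K L) \<longleftrightarrow> \<not> H u v"
    if "u \<in> X \<union> Y" "v \<in> X \<union> Y" "u \<noteq> v" for u v
    using that f(2)[of u v] g(2)[of u v] H[of u v] H[of v u] fV gV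
    by (auto simp: hX hY graph_join_def graph_union_def)
  ultimately show ?thesis unfolding co_iso_def bij_betw_def by blast
qed

lemma co_iso_joinE:
  assumes "co_iso H V (graph_join K L)"
  obtains X Y where "V = X \<union> Y" "X \<inter> Y = {}" "co_iso H X K" "co_iso H Y L"
    "\<forall>x\<in>X. \<forall>y\<in>Y. \<not> H x y"
proof -
  obtain f where f: "bij_betw f V (pverts (graph_join K L))"
    and adj: "\<And>u v. u \<in> V \<Longrightarrow> v \<in> V \<Longrightarrow> u \<noteq> v \<Longrightarrow> (f u, f v) \<in> parcs (graph_join K L) \<longleftrightarrow> \<not> H u v"
    using assms unfolding co_iso_def by blast
  define X where "X = {u \<in> V. f u \<in> Inl ` pverts K}"
  define Y where "Y = {u \<in> V. f u \<in> Inr ` pverts L}"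
  have fV: "f ` V = Inl ` pverts K \<union> Inr ` pverts L"
    using f by (simp add: bij_betw_def graph_join_def Plus_def)
  have inj: "inj_on f V" using f by (simp add: bij_betw_def)
  have XV: "X \<subseteq> V" "Y \<subseteq> V" by (auto simp: X_def Y_def)
  have "V = X \<union> Y" using fV by (auto simp: X_def Y_def)
  moreover have "X \<inter> Y = {}" by (auto simp: X_def Y_def)
  moreover have "co_iso H X K"
  proof -
    have fX: "f u = Inl (projl (f u))" if "u \<in> X" for u using that by (auto simp: X_def)
    have "f ` X = f ` V \<inter> Inl ` pverts K" by (auto simp: X_def)
    then have img: "f ` X = Inl ` pverts K" unfolding fV by auto
    have "(projl \<circ> f) ` X = projl ` f ` X" by (simp only: image_comp)
    also have "\<dots> = pverts K" unfolding img by (simp add: image_image)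
    finally have "(projl \<circ> f) ` X = pverts K" .
    moreover have "inj_on (projl \<circ> f) X"
    proof (rule inj_onI)
      fix u v assume uv: "u \<in> X" "v \<in> X" "(projl \<circ> f) u = (projl \<circ> f) v"
      then have "f u = f v" using fX[of u] fX[of v] by simp
      then show "u = v" using inj uv XV by (auto dest: inj_onD)
    qed
    moreover have "((projl \<circ> f) u, (projl \<circ> f) v) \<in> parcs K \<longleftrightarrow> \<not> H u v"
      if "u \<in> X" "v \<in> X" "u \<noteq> v" for u v
    proof -
      have "(Inl (projl (f u)), Inl (projl (f v))) \<in> parcs (graph_join K L) \<longleftrightarrow> \<not> H u v"
        using adj[of u v] fX[of u] fX[of v] that XV by auto
      then show ?thesis by (simp add: graph_join_def graph_union_def)
    qed
    ultimately show ?thesis unfolding co_iso_def bij_betw_def by blast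
  qed
  moreover have "co_iso H Y L"
  proof -
    have fY: "f u = Inr (projr (f u))" if "u \<in> Y" for u using that by (auto simp: Y_def)
    have "f ` Y = f ` V \<inter> Inr ` pverts L" by (auto simp: Y_def)
    then have img: "f ` Y = Inr ` pverts L" unfolding fV by auto
    have "(projr \<circ> f) ` Y = projr ` f ` Y" by (simp only: image_comp)
    also have "\<dots> = pverts L" unfolding img by (simp add: image_image)
    finally have "(projr \<circ> f) ` Y = pverts L" .
    moreover have "inj_on (projr \<circ> f) Y"
    proof (rule inj_onI)
      fix u v assume uv: "u \<in> Y" "v \<in> Y" "(projr \<circ> f) u = (projr \<circ> f) v"
      then have "f u = f v" using fY[of u] fY[of v] by simp
      then show "u = v" using inj uv XV by (auto dest: inj_onD)
    qed
    moreover have "((projr \<circ> f) u, (projr \<circ> f) v) \<in> parcs L \<longleftrightarrow> \<not> H u v"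
      if "u \<in> Y" "v \<in> Y" "u \<noteq> v" for u v
    proof -
      have "(Inr (projr (f u)), Inr (projr (f v))) \<in> parcs (graph_join K L) \<longleftrightarrow> \<not> H u v"
        using adj[of u v] fY[of u] fY[of v] that XV by auto
      then show ?thesis by (simp add: graph_join_def graph_union_def)
    qed
    ultimately show ?thesis unfolding co_iso_def bij_betw_def by blast
  qed
  moreover have "\<forall>x\<in>X. \<forall>y\<in>Y. \<not> H x y"
  proof (intro ballI)
    fix x y assume xy: "x \<in> X" "y \<in> Y"
    obtain a b where ab: "f x = Inl a" "a \<in> pverts K" "f y = Inr b" "b \<in> pverts L"
      using xy by (auto simp: X_def Y_def)
    then have "x \<noteq> y" by auto
    then show "\<not> H x y" using ab adj[of x y] xy XV by (auto simp: graph_join_def)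
  qed
  ultimately show ?thesis using that by blast
qed

lemma co_iso_complete:
  assumes "finite Z" "\<And>u v. u \<in> Z \<Longrightarrow> v \<in> Z \<Longrightarrow> \<not> H u v"
  shows "co_iso H Z (complete_graph (card Z))"
proof -
  obtain f where f: "bij_betw f Z {0..<card Z}" using ex_bij_betw_finite_nat[OF assms(1)] by blast
  have "(f u, f v) \<in> parcs (complete_graph (card Z)) \<longleftrightarrow> \<not> H u v" if "u \<in> Z" "v \<in> Z" "u \<noteq> v" for u v
  proof -
    have "f u < card Z" "f v < card Z" "f u \<noteq> f v"
      using f that by (auto simp: bij_betw_def dest: inj_onD)
    then show ?thesis using assms that by (simp add: complete_graph_def)
  qed
  moreover have "bij_betw f Z (pverts (complete_graph (card Z)))"
    using f by (simp add: complete_graph_def lessThan_atLeast0)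
  ultimately show ?thesis unfolding co_iso_def by blast
qed

lemma co_iso_completeE:
  assumes "co_iso H Z (complete_graph r)" "\<And>u. \<not> H u u"
  shows "card Z = r" "u \<in> Z \<Longrightarrow> v \<in> Z \<Longrightarrow> \<not> H u v"
proof -
  obtain f where f': "bij_betw f Z (pverts (complete_graph r))"
    and adj: "\<And>u v. u \<in> Z \<Longrightarrow> v \<in> Z \<Longrightarrow> u \<noteq> v \<Longrightarrow> (f u, f v) \<in> parcs (complete_graph r) \<longleftrightarrow> \<not> H u v"
    using assms(1) unfolding co_iso_def by blast
  have f: "bij_betw f Z {..<r}" using f' by (simp add: complete_graph_def)
  show "card Z = r" using bij_betw_same_card[OF f] by simp
  assume uv: "u \<in> Z" "v \<in> Z"
  show "\<not> H u v"
  proof (cases "u = v")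
    case False
    have "f u < r" "f v < r" "f u \<noteq> f v" using f uv False by (auto simp: bij_betw_def dest: inj_onD)
    then show ?thesis using adj[OF uv False] by (simp add: complete_graph_def)
  qed (use assms in simp)
qed

text \<open>In the complement the copies of K2 become parts of size 2; \<open>l\<close> gives the
  index of the copy that contains a vertex.\<close>

lemma co_iso_copiesE:
  assumes "co_iso H Z (graph_copies m (complete_graph 2))" "\<And>u. \<not> H u u" "finite Z"
  obtains l :: "'a \<Rightarrow> nat" where "card Z = 2 * m" "\<forall>u\<in>Z. \<forall>v\<in>Z. H u v \<longleftrightarrow> l u \<noteq> l v"
    "\<forall>u\<in>Z. card {v \<in> Z. l v = l u} = 2"
proof -
  obtain f where f': "bij_betw f Z (pverts (graph_copies m (complete_graph 2)))"
    and adj: "\<And>u v. u \<in> Z \<Longrightarrow> v \<in> Z \<Longrightarrow> u \<noteq> v \<Longrightarrow>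
      (f u, f v) \<in> parcs (graph_copies m (complete_graph 2)) \<longleftrightarrow> \<not> H u v"
    using assms(1) unfolding co_iso_def by blast
  have f: "bij_betw f Z ({..<m} \<times> {..<2})" using f' by (simp add: complete_graph_def graph_copies_def)
  show ?thesis
  proof (rule that[of "fst \<circ> f"])
    show "card Z = 2 * m" using bij_betw_same_card[OF f] by simp
    have "H u v \<longleftrightarrow> (fst \<circ> f) u \<noteq> (fst \<circ> f) v" if uv: "u \<in> Z" "v \<in> Z" for u v
    proof (cases "u = v")
      case False
      have fuv: "f u \<in> {..<m} \<times> {..<2}" "f v \<in> {..<m} \<times> {..<2}" "f u \<noteq> f v"
        using f uv False by (auto simp: bij_betw_def dest: inj_onD)
      then have "(f u, f v) \<in> parcs (graph_copies m (complete_graph 2)) \<longleftrightarrow> fst (f u) = fst (f v)"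
        by (cases "f u"; cases "f v") (auto simp: graph_copies_def complete_graph_def)
      then show ?thesis using adj[OF uv False] by auto
    qed (use assms in simp)
    then show "\<forall>u\<in>Z. \<forall>v\<in>Z. H u v \<longleftrightarrow> (fst \<circ> f) u \<noteq> (fst \<circ> f) v" by blast
    show "\<forall>u\<in>Z. card {v \<in> Z. (fst \<circ> f) v = (fst \<circ> f) u} = 2"
    proof
      fix u assume u: "u \<in> Z"
      have "fst (f u) < m" using bij_betwE[OF f] u by (auto simp: mem_Times_iff)
      moreover have "f ` {v \<in> Z. (fst \<circ> f) v = (fst \<circ> f) u} = f ` Z \<inter> {x. fst x = fst (f u)}"
        by auto
      moreover have "f ` Z = {..<m} \<times> {..<2}" using f by (simp add: bij_betw_def)
      ultimately have "f ` {v \<in> Z. (fst \<circ> f) v = (fst \<circ> f) u} = {fst (f u)} \<times> {..<2}"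
        by auto
      moreover have "inj_on f {v \<in> Z. (fst \<circ> f) v = (fst \<circ> f) u}"
        using f by (auto simp: bij_betw_def intro: inj_on_subset)
      ultimately show "card {v \<in> Z. (fst \<circ> f) v = (fst \<circ> f) u} = 2"
        using card_image[of f "{v \<in> Z. (fst \<circ> f) v = (fst \<circ> f) u}"] by simp
    qed
  qed
qed

text \<open>The complement of the disjoint union of K5 and K1 is a star with five leaves, whose
  centre is the vertex of K1.\<close>

lemma co_iso_starE:
  assumes "co_iso H Z (graph_union (complete_graph 5) (complete_graph 1))" "\<And>u. \<not> H u u"
  obtains c P where "Z = insert c P" "c \<notin> P" "card P = 5" 
    "\<forall>p\<in>P. H c p \<and> H p c" "\<forall>p\<in>P. \<forall>q\<in>P. \<not> H p q"
proof -
  let ?K = "graph_union (complete_graph 5) (complete_graph 1)"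
  obtain f where f': "bij_betw f Z (pverts ?K)"
    and adj: "\<And>u v. u \<in> Z \<Longrightarrow> v \<in> Z \<Longrightarrow> u \<noteq> v \<Longrightarrow> (f u, f v) \<in> parcs ?K \<longleftrightarrow> \<not> H u v"
    using assms(1) unfolding co_iso_def by blast
  have f: "bij_betw f Z ({..<5::nat} <+> {..<1::nat})" using f' by (simp add: complete_graph_def graph_union_def)
  define g where "g = the_inv_into Z f"
  have g: "bij_betw g ({..<5::nat} <+> {..<1::nat}) Z" using f by (simp add: g_def bij_betw_the_inv_into)
  have fg: "f (g x) = x" if "x \<in> {..<5::nat} <+> {..<1::nat}" for x
    using f that by (simp add: g_def f_the_inv_into_f_bij_betw)
  have H: "H (g x) (g y) \<longleftrightarrow> (x, y) \<notin> parcs ?K" if "x \<in> {..<5::nat} <+> {..<1::nat}" "y \<in> {..<5::nat} <+> {..<1::nat}" "x \<noteq> y" for x y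
  proof -
    have "g x \<in> Z" "g y \<in> Z" "g x \<noteq> g y" using g that by (auto simp: bij_betw_def dest: inj_onD)
    then show ?thesis using adj[of "g x" "g y"] fg that by simp
  qed
  define P where "P = g ` Inl ` {..<5::nat}"
  have inj: "inj_on g ({..<5::nat} <+> {..<1::nat})" using g by (simp add: bij_betw_def)
  show ?thesis
  proof (rule that[of "g (Inr 0)" P])
    have "Z = g ` ({..<5::nat} <+> {..<1::nat})" using g by (simp add: bij_betw_def)
    also have "{..<5::nat} <+> {..<1::nat} = insert (Inr 0) (Inl ` {..<5::nat})" by (auto simp: Plus_def)
    finally show "Z = insert (g (Inr 0)) P" by (simp add: P_def)
    show "g (Inr 0) \<notin> P" using inj by (auto simp: P_def dest!: inj_onD)
    show "card P = 5" unfolding P_def image_image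
      by (subst card_image) (use inj in \<open>auto simp: inj_on_def\<close>)
    show "\<forall>p\<in>P. H (g (Inr 0)) p \<and> H p (g (Inr 0))"
      using H by (auto simp: P_def graph_union_def)
    show "\<forall>p\<in>P. \<forall>q\<in>P. \<not> H p q"
    proof (intro ballI)
      fix p q assume pq: "p \<in> P" "q \<in> P"
      obtain i j where ij: "p = g (Inl i)" "q = g (Inl j)" "i < 5" "j < 5"
        using pq by (auto simp: P_def)
      then show "\<not> H p q"
        using H[of "Inl i" "Inl j"] assms(2)
        by (cases "i = j") (auto simp: graph_union_def complete_graph_def)
    qed
  qed
qed

lemma co_iso_star:
  assumes "Z = insert c P" "c \<notin> P" "card P = 5"
    and "\<And>p. p \<in> P \<Longrightarrow> H c p \<and> H p c" "\<And>p q. p \<in> P \<Longrightarrow> q \<in> P \<Longrightarrow> \<not> H p q"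
  shows "co_iso H Z (graph_union (complete_graph 5) (complete_graph 1))"
proof -
  have "finite P" using assms(3) by (simp add: card_ge_0_finite)
  then obtain f where f: "bij_betw f P {0..<5::nat}" using ex_bij_betw_finite_nat[of P] assms(3) by auto
  define h where "h = (\<lambda>u. if u = c then Inr (0::nat) else Inl (f u))"
  have hP: "h u = Inl (f u)" if "u \<in> P" for u using that assms(2) by (auto simp: h_def)
  have hc: "h c = Inr (0::nat)" by (simp add: h_def)
  have "h ` P = Inl ` {..<5::nat}" using f by (force simp: hP bij_betw_def)
  then have "h ` Z = {..<5::nat} <+> {..<1::nat}" by (auto simp: assms(1) hc Plus_def)
  moreover have "inj_on h Z"
    using f unfolding assms(1) by (auto simp: inj_on_def hP hc bij_betw_def)
  moreover have "(h u, h v) \<in> parcs (graph_union (complete_graph 5) (complete_graph 1)) \<longleftrightarrow> \<not> H u v"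
    if "u \<in> Z" "v \<in> Z" "u \<noteq> v" for u v
  proof -
    have "f p < 5" if "p \<in> P" for p using f that by (auto simp: bij_betw_def)
    moreover have "f p \<noteq> f q" if "p \<in> P" "q \<in> P" "p \<noteq> q" for p q
      using f that by (auto simp: bij_betw_def dest: inj_onD)
    ultimately show ?thesis
      using that assms(4)[of u] assms(4)[of v] assms(5)[of u v] unfolding assms(1)
      by (auto simp: hP hc graph_union_def complete_graph_def)
  qed
  ultimately show ?thesis
    unfolding co_iso_def bij_betw_def
    by (intro exI[of _ h]) (auto simp: graph_union_def complete_graph_def)
qed

context two_multipartite
begin

text \<open>The bijection sends a vertex to the index of its part together with its index inside
  that part.\<close>

lemma co_iso_paired:
  assumes "\<And>w. w \<in> side u \<Longrightarrow> card (part w) = 2"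
  obtains m where "card (side u) = 2 * m" "co_iso H (side u) (graph_copies m (complete_graph 2))"
proof -
  let ?Q = "part ` side u"
  have finQ: "finite ?Q" by simp
  obtain q where q: "bij_betw q ?Q {0..<card ?Q}" using ex_bij_betw_finite_nat[OF finQ] by blast
  have "\<exists>r. bij_betw r A {0..<2::nat}" if A: "A \<in> ?Q" for A
  proof -
    obtain w where "A = part w" "w \<in> side u" using A by blast
    then have "finite A" "card A = 2" using assms by auto
    then show ?thesis using ex_bij_betw_finite_nat[of A] by simp
  qed
  then obtain r where r: "\<And>A. A \<in> ?Q \<Longrightarrow> bij_betw (r A) A {0..<2::nat}" by metis
  let ?f = "\<lambda>w. (q (part w), r (part w) w)"
  have V: "w \<in> V" if "w \<in> side u" for w using that by (simp add: side_def)
  have qlt: "q (part w) < card ?Q" if "w \<in> side u" for w using q that by (auto simp: bij_betw_def)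
  have rlt: "r (part w) w < 2" if "w \<in> side u" for w
    using r[of "part w"] that self_in_part[OF V[OF that]] by (auto simp: bij_betw_def)
  have qeq: "q (part v) = q (part w) \<longleftrightarrow> part v = part w" if "v \<in> side u" "w \<in> side u" for v w
    using q that by (auto simp: bij_betw_def dest: inj_onD)
  have parteq: "part v = part w \<longleftrightarrow> \<not> H v w" if "v \<in> side u" "w \<in> side u" for v w
  proof
    assume "part v = part w"
    then show "\<not> H v w" using self_in_part[OF V[OF that(2)]] by (auto simp: part_def)
  next
    assume "\<not> H v w"
    then have "w \<in> part v" using that by (auto simp: part_def side_def)
    then show "part v = part w" using part_eq[OF V[OF that(1)]] by simp
  qed
  have inj: "inj_on ?f (side u)"
  proof (rule inj_onI)
    fix v w assume vw: "v \<in> side u" "w \<in> side u" "?f v = ?f w"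
    then have "part v = part w" using qeq by simp
    then show "v = w"
      using vw r[of "part v"] self_in_part[OF V[OF vw(1)]] self_in_part[OF V[OF vw(2)]]
      by (auto simp: bij_betw_def dest!: inj_onD)
  qed
  have "{..<card ?Q} \<times> {..<2} \<subseteq> ?f ` side u"
  proof
    fix x assume "x \<in> {..<card ?Q} \<times> {..<2::nat}"
    then obtain i j where x: "x = (i, j)" "i < card ?Q" "j < 2" by auto
    then have "i \<in> q ` ?Q" using q by (auto simp: bij_betw_def)
    then obtain w where w: "w \<in> side u" "i = q (part w)" by blast
    then have "j \<in> r (part w) ` part w" using r[of "part w"] x(3) by (auto simp: bij_betw_def)
    then obtain z where z: "z \<in> part w" "j = r (part w) z" by blast
    moreover have "part z = part w" using part_eq[OF V[OF w(1)] z(1)] .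
    moreover have "z \<in> side u" using z(1) w(1) by (auto simp: part_def side_def)
    ultimately have "x = ?f z" "z \<in> side u" using x w by simp_all
    then show "x \<in> ?f ` side u" by blast
  qed
  then have img: "?f ` side u = {..<card ?Q} \<times> {..<2}" using qlt rlt by auto
  have "(?f v, ?f w) \<in> parcs (graph_copies (card ?Q) (complete_graph 2)) \<longleftrightarrow> \<not> H v w"
    if vw: "v \<in> side u" "w \<in> side u" "v \<noteq> w" for v w
  proof -
    have "?f v \<noteq> ?f w" using inj vw by (auto dest: inj_onD)
    then show ?thesis
      using qlt[OF vw(1)] rlt[OF vw(1)] rlt[OF vw(2)] qeq[OF vw(1,2)] parteq[OF vw(1,2)]
      by (auto simp: graph_copies_def complete_graph_def)
  qed
  then have "co_iso H (side u) (graph_copies (card ?Q) (complete_graph 2))"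
    unfolding co_iso_def bij_betw_def
    using inj img by (intro exI[of _ ?f]) (auto simp: graph_copies_def complete_graph_def)
  moreover have "card (side u) = 2 * card ?Q"
    using card_image[OF inj] unfolding img by (simp add: card_cartesian_product)
  ultimately show ?thesis using that by blast
qed

end

context two_multipartite
begin

text \<open>The three families, seen in the complement. The side of \<open>y\<close> is always a
  factor consisting of copies of K2; that of \<open>x\<close> is a complete graph, further copies of
  K2, or the union of K5 and K1. A side of size at least 4 stands for at least two copies, while in
  the last case one copy is enough.\<close>

definition extremal :: bool where
  "extremal \<longleftrightarrow> (\<exists>x\<in>V. \<exists>y\<in>V. S x \<noteq> S y \<and> (\<forall>w\<in>side y. card (part w) = 2)
    \<and> ((\<forall>w\<in>side x. part w = side x) \<and> card (side y) \<ge> 4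
      \<or> (\<forall>w\<in>side x. card (part w) = 2) \<and> card (side x) \<ge> 4 \<and> card (side y) \<ge> 4
      \<or> (\<exists>v. H x v \<and> card (part x) = 1 \<and> card (part v) = 5 \<and> side x = insert x (part v))))"

lemma self_in_side: "u \<in> V \<Longrightarrow> u \<in> side u" by (simp add: side_def)

lemma sides_cover: "S x \<noteq> S y \<Longrightarrow> V = side x \<union> side y \<and> side x \<inter> side y = {}"
  by (auto simp: side_def)

lemma co_iso_sides:
  assumes "S x \<noteq> S y" "co_iso H (side x) K" "co_iso H (side y) L"
  shows "co_iso H V (graph_join K L)"
proof -
  have "\<not> H a b \<and> \<not> H b a" if "a \<in> side x" "b \<in> side y" for a b
    using that assms(1) H_side by (auto simp: side_def)
  then have "co_iso H (side x \<union> side y) (graph_join K L)"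
    using co_iso_join[OF assms(2,3)] sides_cover[OF assms(1)] by blast
  then show ?thesis using sides_cover[OF assms(1)] by simp
qed

end

section \<open>Rank 2 in the three families\<close>

context two_multipartite_spectral
begin

text \<open>An edgeless side is a single part, and for parts of size 2 the values of
  \<open>M_adjacent\<close> and \<open>M_part\<close> agree; so \<open>M\<close> is constant on the
  side.\<close>

lemma M_uniform_side:
  assumes V: "x \<in> V" and uni: "(\<forall>w\<in>side x. part w = side x) \<or> (\<forall>w\<in>side x. card (part w) = 2)"
    and w: "w \<in> side x" and z: "z \<in> side x"
  shows "M w z = card V + 3 * (real (card (side x)) - real (card (part x))) + 2"
proof -
  have wV: "w \<in> V" "z \<in> V" "side w = side x" using w z by (auto simp: side_def)
  have same: "card (part w) = card (part x)" using uni w self_in_side[OF V] by auto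
  show ?thesis
  proof (cases "H w z")
    case False
    then have "z \<in> part w" using z wV by (auto simp: part_def)
    then show ?thesis using M_part[OF wV(1)] wV(3) same by simp
  next
    case True
    then have "z \<notin> part w" by (auto simp: part_def)
    then have "\<forall>w\<in>side x. card (part w) = 2" using uni w z by blast
    then have "card (part w) = 2" "card (part z) = 2" "card (part x) = 2"
      using w z self_in_side[OF V] by blast+
    then show ?thesis using M_adjacent[OF True] wV(3) by simp
  qed
qed

lemma M_uniform:
  assumes V: "x \<in> V" and uni: "(\<forall>w\<in>side x. part w = side x) \<or> (\<forall>w\<in>side x. card (part w) = 2)"
    and w: "w \<in> side x" and z: "z \<in> V"
  shows "M w z = M x z"
proof (cases "S z = S x")
  case True
  then have "z \<in> side x" using z by (simp add: side_def)
  then show ?thesis using M_uniform_side[OF V uni] w self_in_side[OF V] by simp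
next
  case False
  have "w \<in> V" "S w = S x" "side w = side x" using w by (auto simp: side_def)
  moreover have "card (part w) = card (part x)" using uni w self_in_side[OF V] by auto
  ultimately show ?thesis using M_across[of w z] M_across[OF V z] z False by simp
qed

text \<open>By \<open>M_uniform\<close>, each row of \<open>M\<close> is equal to the row of
  \<open>x\<close> or to the row of \<open>y\<close>.\<close>

lemma card_exc_uniform:
  assumes V: "x \<in> V" "y \<in> V" and S: "S x \<noteq> S y"
    and x: "(\<forall>w\<in>side x. part w = side x) \<or> (\<forall>w\<in>side x. card (part w) = 2)"
    and y: "(\<forall>w\<in>side y. part w = side y) \<or> (\<forall>w\<in>side y. card (part w) = 2)"
    and minor: "M x x * M y y - (M x y)\<^sup>2 \<noteq> 0"
  shows "card exc = 2"
proof (rule card_exc_eq_2[OF V minor])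
  fix w z assume wz: "w \<in> V" "z \<in> V"
  show "M w z = of_bool (S w = S x) * M x z + of_bool (S w \<noteq> S x) * M y z"
  proof (cases "S w = S x")
    case True
    then show ?thesis using M_uniform[OF V(1) x, of w z] wz by (simp add: side_def)
  next
    case False
    then have "S w = S y" using S by auto
    then show ?thesis using M_uniform[OF V(2) y, of w z] wz False by (simp add: side_def)
  qed
qed

text \<open>Up to equality there are three rows, those of the centre \<open>x\<close>, of a leaf
  \<open>v\<close> and of \<open>y\<close>. With five leaves the row of the centre is a combination
  of the other two.\<close>

lemma card_exc_star:
  assumes xv: "H x v" and star: "card (part x) = 1" "card (part v) = 5" "side x = insert x (part v)"
    and y: "y \<in> V" "S x \<noteq> S y" and y2: "\<forall>w\<in>side y. card (part w) = 2"
  shows "card exc = 2"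
proof -
  have V: "x \<in> V" "v \<in> V" and Sv: "S v = S x" using xv H_V H_V2 H_side by blast+
  have side: "side v = side x" using Sv by (simp add: side_def)
  have "x \<notin> part v" using xv H_sym by (auto simp: part_def)
  then have sx: "card (side x) = 6" using star by simp
  let ?s = "real (card (side y))"
  have cV: "real (card V) = 6 + ?s" using card_V[OF y(2)] sx by simp
  have py: "card (part y) = 2" using y2 self_in_side[OF y(1)] by blast
  have s2: "?s \<ge> 2" using card_part_le[of y] py by simp
  have pv: "z \<in> V" "S z = S x" "part z = part v" "side z = side x" if "z \<in> part v" for z
    using that part_eq[OF V(2) that] Sv by (auto simp: part_def side_def)
  have pw: "z \<in> V" "S z = S y" "card (part z) = 2" "side z = side y" if "z \<in> side y" for z
    using that y2 by (auto simp: side_def)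
  have vv: "M z z' = ?s + 11" if "z \<in> part v" "z' \<in> part v" for z z'
    using M_part[OF pv(1)[OF that(1)], of z'] that pv(3,4)[OF that(1)] cV sx star by simp
  have xx: "M x x = ?s + 23"
    using M_part[OF V(1) self_in_part[OF V(1)]] cV sx star by simp
  have xv': "M x z = ?s + 16" "M z x = ?s + 16" if "z \<in> part v" for z
    using M_adjacent[OF adjacent_parts[OF xv self_in_part[OF V(1)] that]]
      M_adjacent[OF H_sym[OF adjacent_parts[OF xv self_in_part[OF V(1)] that]]]
      pv[OF that] cV sx star by simp_all
  have yy: "M w z = 4 * ?s + 2" if "w \<in> side y" "z \<in> side y" for w z
    using M_uniform_side[OF y(1) disjI2[OF y2] that] cV py by simp
  have xy: "M x w = 2 * ?s + 11" "M w x = 2 * ?s + 11" if "w \<in> side y" for w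
    using M_across[OF V(1) pw(1)[OF that]] M_across[OF pw(1)[OF that] V(1)] pw[OF that] y(2) cV sx star
    by simp_all
  have vy: "M z w = 2 * ?s + 7" "M w z = 2 * ?s + 7" if "z \<in> part v" "w \<in> side y" for z w
    using M_across[OF pv(1)[OF that(1)] pw(1)[OF that(2)]] M_across[OF pw(1)[OF that(2)] pv(1)[OF that(1)]]
      pv[OF that(1)] pw[OF that(2)] y(2) cV sx star by simp_all
  have self: "v \<in> part v" "y \<in> side y" using self_in_part V self_in_side y by auto
  have cases: "w = x \<or> w \<in> part v \<or> w \<in> side y" if "w \<in> V" for w
    using that star(3) sides_cover[OF y(2)] by blast
  \<comment> \<open>the rows satisfy \<open>3 M\<^sub>x = 5 M\<^sub>v - M\<^sub>y\<close>\<close>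
  define l where "l w = (if w = x then 5 / 3 else of_bool (S w = S x) :: real)" for w
  define m where "m w = (if w = x then - 1 / 3 else of_bool (S w \<noteq> S x) :: real)" for w
  have lm: "l x = 5 / 3" "m x = - 1 / 3" by (simp_all add: l_def m_def)
  have lmv: "l z = 1" "m z = 0" if "z \<in> part v" for z
    using that pv[OF that] \<open>x \<notin> part v\<close> by (auto simp: l_def m_def)
  have lmy: "l w = 0" "m w = 1" if "w \<in> side y" for w
    using pw[OF that] y(2) by (auto simp: l_def m_def)
  show ?thesis
  proof (rule card_exc_eq_2[OF V(2) y(1)])
    have "M v v * M y y - (M v y)\<^sup>2 = 18 * ?s - 27"
      using self by (simp add: vv yy vy power2_eq_square algebra_simps)
    then show "M v v * M y y - (M v y)\<^sup>2 \<noteq> 0" using s2 by simp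
    fix w z assume "w \<in> V" "z \<in> V"
    then have "w = x \<or> w \<in> part v \<or> w \<in> side y" "z = x \<or> z \<in> part v \<or> z \<in> side y"
      using cases by blast+
    then show "M w z = l w * M v z + m w * M y z"
      using self by (elim disjE) (simp_all add: lm lmv lmy xx xv' xy vv vy yy field_simps)
  qed
qed

lemma extremal_card_exc:
  assumes extremal
  shows "card exc = 2"
proof -
  obtain x y where V: "x \<in> V" "y \<in> V" and S: "S x \<noteq> S y" and y: "\<forall>w\<in>side y. card (part w) = 2"
    and x: "(\<forall>w\<in>side x. part w = side x) \<and> card (side y) \<ge> 4
      \<or> (\<forall>w\<in>side x. card (part w) = 2) \<and> card (side x) \<ge> 4 \<and> card (side y) \<ge> 4
      \<or> (\<exists>v. H x v \<and> card (part x) = 1 \<and> card (part v) = 5 \<and> side x = insert x (part v))"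
    using assms unfolding extremal_def by blast
  let ?r = "real (card (side x))" and ?s = "real (card (side y))"
  have cV: "real (card V) = ?r + ?s" using card_V[OF S] by simp
  have py: "card (part y) = 2" using y self_in_side[OF V(2)] by blast
  have Myy: "M y y = ?r + ?s + 3 * (?s - 2) + 2"
    using M_part[OF V(2) self_in_part[OF V(2)]] cV py by simp
  from x show ?thesis
  proof (elim disjE conjE exE)
    assume ind: "\<forall>w\<in>side x. part w = side x" and s4: "card (side y) \<ge> 4"
    have px: "part x = side x" using ind self_in_side[OF V(1)] by blast
    have "M x x = ?r + ?s + 2"
      using M_part[OF V(1) self_in_part[OF V(1)]] cV px by simp
    moreover have "M x y = ?r + ?s + (?s - 2) + 2" using M_across[OF V S] cV px py by simp
    ultimately have "M x x * M y y - (M x y)\<^sup>2 = (?s - 2) * (?r + 4)"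
      by (simp add: Myy power2_eq_square algebra_simps)
    moreover have "(?s - 2) * (?r + 4) > 0" using s4 by simp
    ultimately have "M x x * M y y - (M x y)\<^sup>2 \<noteq> 0" by linarith
    then show ?thesis using card_exc_uniform[OF V S disjI1[OF ind] disjI2[OF y]] by blast
  next
    assume pair: "\<forall>w\<in>side x. card (part w) = 2" and r4: "card (side x) \<ge> 4" and s4: "card (side y) \<ge> 4"
    have px: "card (part x) = 2" using pair self_in_side[OF V(1)] by blast
    have Mxx: "M x x = ?r + ?s + 3 * (?r - 2) + 2"
      using M_part[OF V(1) self_in_part[OF V(1)]] cV px by simp
    have Mxy: "M x y = ?r + ?s + (?r - 2) + (?s - 2) + 2" using M_across[OF V S] cV px py by simp
    \<comment> \<open>Expanded around 4, the least value of both side sizes, the minor has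
      nonnegative terms and a positive constant.\<close>
    have "M x x * M y y - (M x y)\<^sup>2 = 9 * (?r - 4) * (?s - 4) + 24 * (?r - 4) + 24 * (?s - 4) + 60"
      unfolding Mxx Mxy Myy by (simp add: power2_eq_square algebra_simps)
    moreover have "?r - 4 \<ge> 0" "?s - 4 \<ge> 0" using r4 s4 by simp_all
    moreover from this have "9 * (?r - 4) * (?s - 4) \<ge> 0" by simp
    ultimately have "M x x * M y y - (M x y)\<^sup>2 \<noteq> 0" by argo
    then show ?thesis using card_exc_uniform[OF V S disjI2[OF pair] disjI2[OF y]] by blast
  next
    fix v assume "H x v" "card (part x) = 1" "card (part v) = 5" "side x = insert x (part v)"
    then show ?thesis using card_exc_star[OF _ _ _ _ V(2) S y] by blast
  qed
qed

end

section \<open>Isomorphism types from the shapes of the sides\<close>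

context extremal_sides
begin

lemma paired_side_ge:
  assumes "H a b" "\<forall>w\<in>side a. card (part w) = 2"
  shows "card (side a) \<ge> 4"
proof -
  have ab: "a \<in> side a" "b \<in> side a" "side b = side a" using H_V H_V2 H_side assms(1) by (auto simp: side_def)
  then have "card (part a \<union> part b) = 4"
    using assms part_disjoint[OF assms(1)] by (simp add: card_Un_disjoint)
  moreover have "part a \<union> part b \<subseteq> side a" using part_subset[of a] part_subset[of b] ab(3) by simp
  ultimately show ?thesis using card_mono[OF finite_side, of "part a \<union> part b" a] by simp
qed

lemma star_classification:
  assumes cv: "H c0 v" and star: "card (part c0) = 1" "card (part v) \<ge> 4" "side c0 = insert c0 (part v)"
    and y: "y \<in> V" "S y \<noteq> S c0"
  shows "\<exists>m\<ge>1. co_iso H V (graph_join (graph_union (complete_graph 5) (complete_graph 1))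
    (graph_copies m (complete_graph 2)))"
proof -
  have V: "c0 \<in> V" "v \<in> V" using cv H_V H_V2 by blast+
  \<comment> \<open>The hypothesis of \<open>star_opposite_sizes\<close> holds for each shape of the
    opposite side: a single part, parts of size 2, or a star, whose centre has a part of size
    1.\<close>
  have small: "card (side z) = card (part z) \<or> (\<exists>y'\<in>V. S y' \<noteq> S c0 \<and> card (part y') \<le> 2)"
    if z: "z \<in> V" "S z \<noteq> S c0" for z
  proof (cases rule: side_cases[OF z(1)])
    case 1
    then show ?thesis using self_in_side[OF z(1)] by metis
  next
    case 2
    then show ?thesis using self_in_side[OF z(1)] z by fastforce
  next
    case (3 c1 w)
    then show ?thesis using z H_V[OF 3(1)] by fastforce
  qed
  have sizes: "card (part v) = 5" "\<And>z. z \<in> V \<Longrightarrow> S z \<noteq> S c0 \<Longrightarrow> card (part z) = 2"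
    using star_opposite_sizes[OF cv star(1,3,2) _ small] y by blast+
  have "card (part w) = 2" if "w \<in> side y" for w
    using sizes(2)[of w] that y by (auto simp: side_def)
  then obtain m where m: "card (side y) = 2 * m" "co_iso H (side y) (graph_copies m (complete_graph 2))"
    using co_iso_paired by blast
  have "card (side y) > 0" using self_in_side[OF y(1)] by (auto simp: card_gt_0_iff)
  then have "m \<ge> 1" using m(1) by simp
  have "co_iso H (side c0) (graph_union (complete_graph 5) (complete_graph 1))"
  proof (rule co_iso_star[OF star(3) _ sizes(1)])
    show "c0 \<notin> part v" using cv H_sym by (auto simp: part_def)
    show "H c0 p \<and> H p c0" if "p \<in> part v" for p
      using adjacent_parts[OF cv self_in_part[OF V(1)] that] H_sym by blast
    show "\<not> H p q" if "p \<in> part v" "q \<in> part v" for p q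
      using part_eq[OF V(2) that(1)] that(2) by (auto simp: part_def)
  qed
  then show ?thesis using co_iso_sides[OF _ _ m(2)] y(2) \<open>m \<ge> 1\<close> by metis
qed

text \<open>The edge shows that the side of \<open>x\<close> is not edgeless. A star on either side
  is settled by \<open>star_classification\<close>; otherwise the side of \<open>x\<close> has parts
  of size 2, and that of \<open>y\<close> is edgeless or has parts of size 2.\<close>

lemma classification:
  assumes xe: "H x x'" and y: "y \<in> V" "S y \<noteq> S x"
  shows "(\<exists>m\<ge>1. co_iso H V (graph_join (graph_union (complete_graph 5) (complete_graph 1))
      (graph_copies m (complete_graph 2))))
    \<or> (\<exists>r\<ge>1. \<exists>m\<ge>2. co_iso H V (graph_join (complete_graph r) (graph_copies m (complete_graph 2))))
    \<or> (\<exists>m1\<ge>2. \<exists>m2\<ge>2. co_iso H V (graph_join (graph_copies m1 (complete_graph 2))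
      (graph_copies m2 (complete_graph 2))))"
    (is "?A \<or> ?B \<or> ?C")
proof -
  have x: "x \<in> V" "x \<in> side x" "x' \<in> side x" using H_V H_V2 H_side xe by (auto simp: side_def)
  show ?thesis
  proof (cases rule: side_cases[OF x(1)])
    case 1
    then have "x' \<in> part x" using x by blast
    then show ?thesis using xe by (auto simp: part_def)
  next
    case (3 c0 v)
    then have "S y \<noteq> S c0" using y(2) by simp
    then show ?thesis using star_classification[OF 3(1,3,4,5) y(1)] by blast
  next
    case x2: 2
    then obtain m where m: "card (side x) = 2 * m" "co_iso H (side x) (graph_copies m (complete_graph 2))"
      using co_iso_paired by blast
    have "m \<ge> 2" using paired_side_ge[OF xe] x2 m(1) by simp
    show ?thesis
    proof (cases "\<exists>z\<in>side y. \<exists>z'. H z z'")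
      case False
      have "co_iso H (side y) (complete_graph (card (side y)))"
        by (rule co_iso_complete) (use False in auto)
      moreover have "card (side y) > 0" using self_in_side[OF y(1)] by (auto simp: card_gt_0_iff)
      ultimately have ?B
        using co_iso_sides[OF y(2) _ m(2)] \<open>m \<ge> 2\<close> by (metis One_nat_def Suc_leI)
      then show ?thesis by blast
    next
      case True
      then obtain z z' where z: "z \<in> side y" "H z z'" by blast
      then have z': "z' \<in> side y" "side z = side y" using H_V2 H_side by (auto simp: side_def)
      show ?thesis
      proof (cases rule: side_cases[OF y(1)])
        case 1
        then have "z' \<in> part z" using z z' by blast
        then show ?thesis using z by (auto simp: part_def)
      next
        case (3 c0 v)
        then have "S x \<noteq> S c0" using y(2) by simp
        then show ?thesis using star_classification[OF 3(1,3,4,5) x(1)] by blast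
      next
        case y2: 2
        then obtain m' where m': "card (side y) = 2 * m'" "co_iso H (side y) (graph_copies m' (complete_graph 2))"
          using co_iso_paired by blast
        have "m' \<ge> 2" using paired_side_ge[OF z(2)] y2 z'(2) m'(1) by simp
        then have ?C using co_iso_sides[OF y(2) m'(2) m(2)] \<open>m \<ge> 2\<close> by blast
        then show ?thesis by blast
      qed
    qed
  qed
qed

end

text \<open>The parts are the level sets of the labellings \<open>k\<close> and \<open>l\<close>, so
  each family only has to supply labels on its two factors.\<close>

lemma two_multipartite_labels:
  assumes fin: "finite V" and XY: "V = X \<union> Y" "X \<inter> Y = {}"
    and H: "\<forall>u v. H u v \<longrightarrow> u \<in> V" "\<forall>u. \<not> H u u" "\<forall>u v. H u v \<longrightarrow> H v u"
    and cross: "\<forall>x\<in>X. \<forall>y\<in>Y. \<not> H x y"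
    and X: "\<forall>u\<in>X. \<forall>v\<in>X. H u v \<longleftrightarrow> k u \<noteq> k v"
    and Y: "\<forall>u\<in>Y. \<forall>v\<in>Y. H u v \<longleftrightarrow> l u \<noteq> l v"
  shows "two_multipartite V H (\<lambda>u. u \<in> X)"
    "x \<in> X \<Longrightarrow> two_multipartite.side V (\<lambda>u. u \<in> X) x = X"
    "x \<in> X \<Longrightarrow> two_multipartite.part V H (\<lambda>u. u \<in> X) x = {v \<in> X. k v = k x}"
    "y \<in> Y \<Longrightarrow> two_multipartite.side V (\<lambda>u. u \<in> X) y = Y"
    "y \<in> Y \<Longrightarrow> two_multipartite.part V H (\<lambda>u. u \<in> X) y = {v \<in> Y. l v = l y}"
proof -
  have HV: "u \<in> V" "v \<in> V" if "H u v" for u v using H that by blast+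
  have HS: "u \<in> X \<longleftrightarrow> v \<in> X" if "H u v" for u v
    using HV[OF that] that cross H XY(1) by blast
  have tr: "H w u \<or> H w v" if "H u v" "w \<in> V" "(w \<in> X) = (u \<in> X)" for u v w
  proof (cases "u \<in> X")
    case True
    then have "v \<in> X" "w \<in> X" using HS that by auto
    then show ?thesis using X True that(1) by metis
  next
    case False
    then have "u \<in> Y" "v \<in> Y" "w \<in> Y"
      using HS[OF that(1)] HV[OF that(1)] that XY(1) by blast+
    then show ?thesis using Y that(1) by metis
  qed
  show tm: "two_multipartite V H (\<lambda>u. u \<in> X)"
    using fin H HS tr by unfold_locales blast+
  interpret two_multipartite V H "\<lambda>u. u \<in> X" by (rule tm)
  show sx: "side x = X" if "x \<in> X" for x using that XY(1) unfolding side_def by blast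
  show sy: "side y = Y" if "y \<in> Y" for y using that XY unfolding side_def by blast
  show "part x = {v \<in> X. k v = k x}" if "x \<in> X"
    unfolding part_def sx[OF that] using X that by auto
  show "part y = {v \<in> Y. l v = l y}" if "y \<in> Y"
    unfolding part_def sy[OF that] using Y that by auto
qed

lemma extremal_if_co_iso:
  assumes fin: "finite V"
    and H: "\<forall>u v. H u v \<longrightarrow> u \<in> V" "\<forall>u. \<not> H u u" "\<forall>u v. H u v \<longrightarrow> H v u"
    and iso: "(\<exists>m\<ge>1. co_iso H V (graph_join (graph_union (complete_graph 5) (complete_graph 1))
      (graph_copies m (complete_graph 2))))
    \<or> (\<exists>r\<ge>1. \<exists>m\<ge>2. co_iso H V (graph_join (complete_graph r) (graph_copies m (complete_graph 2))))
    \<or> (\<exists>m1\<ge>2. \<exists>m2\<ge>2. co_iso H V (graph_join (graph_copies m1 (complete_graph 2))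
      (graph_copies m2 (complete_graph 2))))"
  shows "\<exists>S. two_multipartite V H S \<and> two_multipartite.extremal V H S"
proof -
  have irr: "\<not> H u u" for u using H(2) by blast
  have fin_part: "finite X" "finite Y" if "V = X \<union> Y" for X Y using fin that by simp_all
  from iso consider (star) m where "m \<ge> 1" "co_iso H V (graph_join (graph_union (complete_graph 5)
      (complete_graph 1)) (graph_copies m (complete_graph 2)))"
    | (complete) r m where "r \<ge> 1" "m \<ge> 2" "co_iso H V (graph_join (complete_graph r) (graph_copies m (complete_graph 2)))"
    | (copies) m1 m2 where "m1 \<ge> 2" "m2 \<ge> 2" "co_iso H V (graph_join (graph_copies m1 (complete_graph 2))
      (graph_copies m2 (complete_graph 2)))"
    by blast
  then show ?thesis
  proof cases
    case star
    obtain X Y where XY: "V = X \<union> Y" "X \<inter> Y = {}"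
      and X: "co_iso H X (graph_union (complete_graph 5) (complete_graph 1))"
      and Y: "co_iso H Y (graph_copies m (complete_graph 2))"
      and cross: "\<forall>x\<in>X. \<forall>y\<in>Y. \<not> H x y"
      by (rule co_iso_joinE[OF star(2)])
    obtain l :: "'a \<Rightarrow> nat" where cY: "card Y = 2 * m" and l: "\<forall>u\<in>Y. \<forall>v\<in>Y. H u v \<longleftrightarrow> l u \<noteq> l v"
      and l2: "\<forall>u\<in>Y. card {v \<in> Y. l v = l u} = 2"
      by (rule co_iso_copiesE[OF Y irr fin_part(2)[OF XY(1)]])
    obtain c P where P: "X = insert c P" "c \<notin> P" "card P = 5"
      and adj: "\<forall>p\<in>P. H c p \<and> H p c" and nadj: "\<forall>p\<in>P. \<forall>q\<in>P. \<not> H p q"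
      by (rule co_iso_starE[OF X irr])
    \<comment> \<open>A truth value serves as label, separating the centre of the star from its
      leaves.\<close>
    have k: "\<forall>u\<in>X. \<forall>v\<in>X. H u v \<longleftrightarrow> (u = c) \<noteq> (v = c)"
      using P adj nadj irr by auto
    note L = two_multipartite_labels[OF fin XY H cross k l]
    interpret two_multipartite V H "\<lambda>u. u \<in> X" by (rule L(1))
    obtain p where p: "p \<in> P" using P(3) by fastforce
    obtain y where y: "y \<in> Y" using cY star(1) by (metis card.empty ex_in_conv mult_is_0 not_one_le_zero zero_neq_numeral)
    have pX: "c \<in> X" "p \<in> X" "p \<noteq> c" using P p by auto
    have part: "part c = {c}" "part p = P" "side c = X"
      using L(2)[OF pX(1)] L(3)[OF pX(1)] L(3)[OF pX(2)] pX P by auto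
    have "extremal"
      unfolding extremal_def
    proof (intro bexI conjI disjI2 exI)
      show "(c \<in> X) \<noteq> (y \<in> X)" using pX y XY by blast
      show "\<forall>w\<in>side y. card (part w) = 2" using L(4)[OF y] L(5) l2 by simp
      show "H c p" using adj p by blast
    qed (use part P pX y XY in auto)
    then show ?thesis using L(1) by blast
  next
    case complete
    obtain X Y where XY: "V = X \<union> Y" "X \<inter> Y = {}"
      and X: "co_iso H X (complete_graph r)"
      and Y: "co_iso H Y (graph_copies m (complete_graph 2))"
      and cross: "\<forall>x\<in>X. \<forall>y\<in>Y. \<not> H x y"
      by (rule co_iso_joinE[OF complete(3)])
    obtain l :: "'a \<Rightarrow> nat" where cY: "card Y = 2 * m" and l: "\<forall>u\<in>Y. \<forall>v\<in>Y. H u v \<longleftrightarrow> l u \<noteq> l v"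
      and l2: "\<forall>u\<in>Y. card {v \<in> Y. l v = l u} = 2"
      by (rule co_iso_copiesE[OF Y irr fin_part(2)[OF XY(1)]])
    have cX: "card X = r" and nadj: "\<And>u v. u \<in> X \<Longrightarrow> v \<in> X \<Longrightarrow> \<not> H u v"
      using co_iso_completeE[OF X irr] by blast+
    \<comment> \<open>A constant label of unit type makes the whole side one part.\<close>
    have k: "\<forall>u\<in>X. \<forall>v\<in>X. H u v \<longleftrightarrow> () \<noteq> ()" using nadj by simp
    note L = two_multipartite_labels[OF fin XY H cross k l]
    interpret two_multipartite V H "\<lambda>u. u \<in> X" by (rule L(1))
    have "X \<noteq> {}" "Y \<noteq> {}" using cX cY complete(1,2) by auto
    then obtain x y where x: "x \<in> X" and y: "y \<in> Y" by blast
    have "extremal"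
      unfolding extremal_def
    proof (intro bexI conjI disjI1)
      show "(x \<in> X) \<noteq> (y \<in> X)" using x y XY by blast
      show "\<forall>w\<in>side y. card (part w) = 2" using L(4)[OF y] L(5) l2 by simp
      show "\<forall>w\<in>side x. part w = side x" using L(2)[OF x] L(3) by simp
      show "4 \<le> card (side y)" using L(4)[OF y] cY complete(2) by simp
    qed (use x y XY in auto)
    then show ?thesis using L(1) by blast
  next
    case copies
    obtain X Y where XY: "V = X \<union> Y" "X \<inter> Y = {}"
      and X: "co_iso H X (graph_copies m1 (complete_graph 2))"
      and Y: "co_iso H Y (graph_copies m2 (complete_graph 2))"
      and cross: "\<forall>x\<in>X. \<forall>y\<in>Y. \<not> H x y"
      by (rule co_iso_joinE[OF copies(3)])
    obtain l :: "'a \<Rightarrow> nat" where cY: "card Y = 2 * m2" and l: "\<forall>u\<in>Y. \<forall>v\<in>Y. H u v \<longleftrightarrow> l u \<noteq> l v"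
      and l2: "\<forall>u\<in>Y. card {v \<in> Y. l v = l u} = 2"
      by (rule co_iso_copiesE[OF Y irr fin_part(2)[OF XY(1)]])
    obtain k :: "'a \<Rightarrow> nat" where cX: "card X = 2 * m1" and k: "\<forall>u\<in>X. \<forall>v\<in>X. H u v \<longleftrightarrow> k u \<noteq> k v"
      and k2: "\<forall>u\<in>X. card {v \<in> X. k v = k u} = 2"
      by (rule co_iso_copiesE[OF X irr fin_part(1)[OF XY(1)]])
    note L = two_multipartite_labels[OF fin XY H cross k l]
    interpret two_multipartite V H "\<lambda>u. u \<in> X" by (rule L(1))
    have "X \<noteq> {}" "Y \<noteq> {}" using cX cY copies(1,2) by auto
    then obtain x y where x: "x \<in> X" and y: "y \<in> Y" by blast
    have "extremal"
      unfolding extremal_def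
    proof (intro bexI conjI disjI2[OF disjI1])
      show "(x \<in> X) \<noteq> (y \<in> X)" using x y XY by blast
      show "\<forall>w\<in>side y. card (part w) = 2" using L(4)[OF y] L(5) l2 by simp
      show "\<forall>w\<in>side x. card (part w) = 2" using L(2)[OF x] L(3) k2 by simp
      show "4 \<le> card (side x)" using L(2)[OF x] cX copies(1) by simp
      show "4 \<le> card (side y)" using L(4)[OF y] cY copies(2) by simp
    qed (use x y XY in auto)
    then show ?thesis using L(1) by blast
  qed
qed

section \<open>Distances\<close>

text \<open>Used with path lengths for \<open>P\<close> and walk lengths for \<open>Q\<close>: a
  walk can be longer than every path, but some path is no longer than the walk.\<close>

lemma Least_eqI_dominated:
  fixes P Q :: "nat \<Rightarrow> bool"
  assumes "\<And>k. P k \<Longrightarrow> Q k" "\<And>k. Q k \<Longrightarrow> \<exists>j\<le>k. P j"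
  shows "(LEAST k. P k) = (LEAST k. Q k)"
proof (cases "\<exists>k. Q k")
  case True
  then obtain k where "Q k" ..
  then have "Q (LEAST k. Q k)" by (rule LeastI)
  then obtain j where j: "j \<le> (LEAST k. Q k)" "P j" using assms(2) by blast
  then have "P (LEAST k. P k)" by (intro LeastI)
  then have "(LEAST k. Q k) \<le> (LEAST k. P k)" using assms(1) by (intro Least_le)
  moreover have "(LEAST k. P k) \<le> j" using j by (intro Least_le)
  ultimately show ?thesis using j by simp
next
  case False
  then have "P = Q" using assms by blast
  then show ?thesis by simp
qed

lemma relpow_sym:
  assumes "sym R" "(u, v) \<in> R ^^ k"
  shows "(v, u) \<in> R ^^ k"
  using assms(2)
proof (induction k arbitrary: v)
  case (Suc k)
  then obtain w where "(u, w) \<in> R ^^ k" "(w, v) \<in> R" by auto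
  then show ?case using Suc.IH assms(1) by (meson relpow_Suc_I2 symD)
qed simp

context pair_graph
begin

lemma awalk_iff_relpow:
  assumes "u \<in> pverts G"
  shows "(\<exists>p. awalk u p v \<and> length p = k) \<longleftrightarrow> (u, v) \<in> parcs G ^^ k"
  using assms
proof (induction k arbitrary: u)
  case 0
  then show ?case by (auto simp: awalk_Nil_iff)
next
  case (Suc k)
  have "(\<exists>p. awalk u p v \<and> length p = Suc k)
    \<longleftrightarrow> (\<exists>w. (u, w) \<in> parcs G \<and> (\<exists>p. awalk w p v \<and> length p = k))"
  proof (intro iffI; elim exE conjE)
    fix p assume p: "awalk u p v" "length p = Suc k"
    then obtain e q where eq: "p = e # q" by (cases p) auto
    then have "(u, snd e) \<in> parcs G" "awalk (snd e) q v" "length q = k"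
      using p by (auto simp: awalk_Cons_iff)
    then show "\<exists>w. (u, w) \<in> parcs G \<and> (\<exists>p. awalk w p v \<and> length p = k)" by blast
  next
    fix w p assume "(u, w) \<in> parcs G" "awalk w p v" "length p = k"
    then show "\<exists>p. awalk u p v \<and> length p = Suc k"
      by (intro exI[of _ "(u, w) # p"]) (simp add: awalk_Cons_iff)
  qed
  also have "\<dots> \<longleftrightarrow> (\<exists>w. (u, w) \<in> parcs G \<and> (w, v) \<in> parcs G ^^ k)"
    using Suc.IH wellformed' by blast
  also have "\<dots> \<longleftrightarrow> (u, v) \<in> parcs G ^^ Suc k"
    by (meson relpow_Suc_D2 relpow_Suc_I2)
  finally show ?case .
qed

text \<open>Reducing a walk to a path only keeps arcs of the walk, and the arcs of a path are
  distinct, so the length does not grow. Distances can thus be computed with powers of the arc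
  relation.\<close>

lemma graph_dist_eq:
  assumes "u \<in> pverts G"
  shows "graph_dist G u v = (LEAST k. (u, v) \<in> parcs G ^^ k)"
  unfolding graph_dist_def
proof (rule Least_eqI_dominated)
  show "(u, v) \<in> parcs G ^^ k" if "\<exists>p. apath u p v \<and> length p = k" for k
    using that awalk_iff_relpow[OF assms] by (auto intro: awalkI_apath)
  fix k assume "(u, v) \<in> parcs G ^^ k"
  then obtain p where p: "awalk u p v" "length p = k" using awalk_iff_relpow[OF assms] by blast
  let ?q = "awalk_to_apath p"
  have q: "apath u ?q v" by (rule apath_awalk_to_apath[OF p(1)])
  then have "distinct ?q" by (auto simp: apath_def intro: distinct_verts_imp_distinct)
  then have "length ?q = card (set ?q)" by (simp add: distinct_card)
  also have "\<dots> \<le> card (set p)" using awalk_to_apath_subset[OF p(1)] by (simp add: card_mono)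
  also have "\<dots> \<le> k" using p(2) card_length by blast
  finally show "\<exists>j\<le>k. \<exists>p. apath u p v \<and> length p = j" using q by blast
qed

end

locale connected_pair_graph = pair_graph G for G :: "'a pair_pre_digraph" +
  assumes connected: "Digraph_Component.connected (with_proj G)"
begin

abbreviation "V \<equiv> pverts G"
abbreviation "E \<equiv> parcs G"
abbreviation "d \<equiv> graph_dist G"

lemma sym_E: "sym E" using pair_sym_arcs by (auto simp: symmetric_def sym_def)

lemma dist_relpow:
  assumes "u \<in> V" "v \<in> V"
  shows "(u, v) \<in> E ^^ d u v"
proof -
  have "(u, v) \<in> rtrancl_on V ((arcs_ends (with_proj G))\<^sup>s)"
    using connected assms unfolding connected_conv by simp
  moreover have "arcs_ends (with_proj G) = E" by (auto simp: arcs_ends_def arc_to_ends_def)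
  moreover have "E\<^sup>s = E" using sym_E by (auto simp: symcl_def sym_def)
  ultimately have "(u, v) \<in> rtrancl_on V E" by simp
  then have "(u, v) \<in> E\<^sup>*" by (induction rule: rtrancl_on_induct) (auto intro: rtrancl_into_rtrancl)
  then obtain k where "(u, v) \<in> E ^^ k" using rtrancl_imp_relpow by blast
  then show ?thesis unfolding graph_dist_eq[OF assms(1)] by (rule LeastI)
qed

lemma dist_le: "u \<in> V \<Longrightarrow> (u, v) \<in> E ^^ k \<Longrightarrow> d u v \<le> k"
  unfolding graph_dist_eq by (rule Least_le)

lemma dist_sym: "u \<in> V \<Longrightarrow> v \<in> V \<Longrightarrow> d u v = d v u"
  using dist_le dist_relpow relpow_sym[OF sym_E] by (meson le_antisym)

lemma dist_0_iff: "u \<in> V \<Longrightarrow> v \<in> V \<Longrightarrow> d u v = 0 \<longleftrightarrow> u = v"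
  using dist_relpow[of u v] dist_le[of u v 0] by auto

lemma dist_Suc:
  assumes "u \<in> V" "v \<in> V" "d u v = Suc k"
  obtains w where "w \<in> V" "(w, v) \<in> E" "d u w = k"
proof -
  obtain w where w: "(u, w) \<in> E ^^ k" "(w, v) \<in> E" using dist_relpow[OF assms(1,2)] assms(3) by auto
  have "w \<in> V" using w(2) wellformed' by blast
  have "d u w \<le> k" using dist_le[OF assms(1) w(1)] .
  moreover have "d u v \<le> Suc (d u w)"
    using dist_relpow[OF assms(1) \<open>w \<in> V\<close>] w(2) by (intro dist_le[OF assms(1)]) auto
  ultimately have "d u w = k" using assms(3) by simp
  then show ?thesis using that w(2) \<open>w \<in> V\<close> by blast
qed

lemma dist_1_iff: "u \<in> V \<Longrightarrow> v \<in> V \<Longrightarrow> d u v = 1 \<longleftrightarrow> (u, v) \<in> E"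
proof
  assume uv: "u \<in> V" "v \<in> V" "d u v = 1"
  obtain w where "w \<in> V" "(w, v) \<in> E" "d u w = 0" using dist_Suc[of u v 0] uv by auto
  then show "(u, v) \<in> E" using dist_0_iff uv by simp
next
  assume uv: "u \<in> V" "v \<in> V" "(u, v) \<in> E"
  then have "d u v \<le> 1" by (intro dist_le) auto
  moreover have "u \<noteq> v" using pair_no_loops[OF uv(3)] by simp
  ultimately show "d u v = 1" using dist_0_iff[OF uv(1,2)] by linarith
qed

lemma dist_le_2: "u \<in> V \<Longrightarrow> (u, w) \<in> E \<Longrightarrow> (w, v) \<in> E \<Longrightarrow> d u v \<le> 2"
  by (intro dist_le) (auto simp: numeral_2_eq_2)

text \<open>Going back along a shortest path from \<open>v\<close> lowers the distance from
  \<open>u\<close> by one at each step.\<close>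

lemma dist_attained:
  assumes "u \<in> V" "v \<in> V" "k \<le> d u v"
  shows "\<exists>w\<in>V. d u w = k"
  using assms(2,3)
proof (induction "d u v - k" arbitrary: v)
  case 0
  then show ?case by (intro bexI[of _ v]) auto
next
  case (Suc m)
  then obtain j where j: "d u v = Suc j" by (cases "d u v") auto
  obtain w where "w \<in> V" "d u w = j" by (rule dist_Suc[OF assms(1) Suc.prems(1) j])
  moreover have "m = j - k" "k \<le> j" using Suc.hyps(2) Suc.prems(2) j by simp_all
  ultimately show ?case using Suc.hyps(1)[of w] by simp
qed

definition "H u v \<longleftrightarrow> u \<in> V \<and> v \<in> V \<and> u \<noteq> v \<and> (u, v) \<notin> E"

lemma H_basic: "H u v \<Longrightarrow> u \<in> V" "\<not> H u u" "H u v \<Longrightarrow> H v u"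
  using symD[OF sym_E] by (auto simp: H_def)

definition "D u v = real (d u v)"

lemma D_H_if_diameter_2:
  assumes "\<And>u v. u \<in> V \<Longrightarrow> v \<in> V \<Longrightarrow> d u v \<le> 2" "u \<in> V" "v \<in> V"
  shows "D u v = of_bool (u \<noteq> v) + of_bool (H u v)"
proof -
  have "d u v = 0 \<or> d u v = 1 \<or> d u v = 2" using assms(1)[OF assms(2,3)] by linarith
  then show ?thesis
    using dist_0_iff[OF assms(2,3)] dist_1_iff[OF assms(2,3)] assms(2,3)
    by (auto simp: D_def H_def)
qed

text \<open>A digraph isomorphism has a separate map on arcs. Under \<open>with_proj\<close> an arc
  is the pair of its ends, so this map is determined by the vertex map.\<close>

lemma co_iso_if_digraph_iso:
  assumes "pair_graph K" "digraph_iso (with_proj G) (with_proj K)"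
  shows "co_iso H V K"
proof -
  obtain h where h: "digraph_isomorphism h" and K: "with_proj K = app_iso h (with_proj G)"
    using assms(2) unfolding digraph_iso_def by blast
  let ?f = "iso_verts h"
  have V: "pverts K = ?f ` V" and E: "parcs K = iso_arcs h ` E"
    and tl: "fst = iso_tail h" and hd: "snd = iso_head h"
    using arg_cong[OF K, of verts] arg_cong[OF K, of arcs] arg_cong[OF K, of tail] arg_cong[OF K, of head]
    by simp_all
  have inj: "inj_on ?f V" using h unfolding digraph_isomorphism_def by simp
  have arc: "iso_arcs h (u, v) = (?f u, ?f v)" if "(u, v) \<in> E" for u v
    using h that unfolding digraph_isomorphism_def tl[symmetric] hd[symmetric]
    by (force simp: prod_eq_iff)
  have "(?f u, ?f v) \<in> parcs K \<longleftrightarrow> (u, v) \<in> E" if uv: "u \<in> V" "v \<in> V" for u v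
  proof
    assume "(?f u, ?f v) \<in> parcs K"
    then obtain a b where ab: "(a, b) \<in> E" "(?f u, ?f v) = (?f a, ?f b)"
      unfolding E using arc by force
    then have "a \<in> V" "b \<in> V" using wellformed' by blast+
    then have "a = u" "b = v" using ab(2) uv inj by (auto dest: inj_onD)
    then show "(u, v) \<in> E" using ab by simp
  next
    assume "(u, v) \<in> E"
    then show "(?f u, ?f v) \<in> parcs K" unfolding E using arc by force
  qed
  then show ?thesis
    unfolding co_iso_def bij_betw_def using inj V by (intro exI[of _ ?f]) (auto simp: H_def)
qed

lemma digraph_iso_if_co_iso:
  assumes "pair_graph K" "co_iso H V K"
  shows "digraph_iso (with_proj G) (with_proj K)"
proof -
  interpret K: pair_graph K by fact
  obtain f where f: "bij_betw f V (pverts K)"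
    and adj: "\<forall>u\<in>V. \<forall>v\<in>V. u \<noteq> v \<longrightarrow> ((f u, f v) \<in> parcs K \<longleftrightarrow> \<not> H u v)"
    using assms(2) unfolding co_iso_def by blast
  have inj: "inj_on f V" and img: "f ` V = pverts K" using f by (simp_all add: bij_betw_def)
  have E: "u \<in> V" "v \<in> V" "u \<noteq> v" if "(u, v) \<in> E" for u v
    using wellformed'[OF that] pair_no_loops[OF that] by simp_all
  let ?h = "\<lparr>iso_verts = f, iso_arcs = map_prod f f, iso_head = snd, iso_tail = fst\<rparr>"
  have "inj_on (map_prod f f) E" using inj E by (auto simp: inj_on_def)
  then have "digraph_isomorphism ?h"
    using inj wf_digraph_axioms by (simp add: digraph_isomorphism_def)
  moreover have "map_prod f f ` E = parcs K"
  proof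
    show "map_prod f f ` E \<subseteq> parcs K" using adj E by (auto simp: H_def)
    show "parcs K \<subseteq> map_prod f f ` E"
    proof
      fix e assume "e \<in> parcs K"
      then obtain a b where ab: "e = (a, b)" "(a, b) \<in> parcs K" by (cases e) auto
      then have "a \<in> pverts K" "b \<in> pverts K" "a \<noteq> b"
        using K.wellformed'[OF ab(2)] K.pair_no_loops[OF ab(2)] by simp_all
      then obtain u v where "u \<in> V" "v \<in> V" "a = f u" "b = f v" "u \<noteq> v" using img by blast
      then have "(u, v) \<in> E" using adj ab by (auto simp: H_def)
      then show "e \<in> map_prod f f ` E" using ab \<open>a = f u\<close> \<open>b = f v\<close> by force
    qed
  qed
  then have "with_proj K = app_iso ?h (with_proj G)"
    using img by (simp add: app_iso_def with_proj_def)
  ultimately show ?thesis unfolding digraph_iso_def by blast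
qed

text \<open>The position \<open>idx\<close> of a vertex in \<open>vs\<close> turns the eigenvectors
  of the distance matrix into functions on the vertices.\<close>

lemma D_spectral:
  assumes vs: "distinct vs" "set vs = V"
  obtains e F where "spectral_decomposition V D (length vs) e F"
    "distance_eigenvalues G vs = image_mset e (mset_set {..<length vs})"
proof -
  let ?n = "length vs" and ?A = "distance_matrix G vs"
  have A: "?A \<in> carrier_mat ?n ?n" by (rule distance_matrix_carrier)
  have vsV: "vs ! i \<in> V" if "i < ?n" for i using nth_mem[OF that] unfolding vs(2) .
  have entry: "?A $$ (i, j) = D (vs ! i) (vs ! j)" if "i < ?n" "j < ?n" for i j
    using that by (simp add: distance_matrix_def D_def)
  have sym: "?A $$ (i, j) = ?A $$ (j, i)" if "i < ?n" "j < ?n" for i j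
    using that entry dist_sym[OF vsV vsV] by (simp add: D_def)
  obtain f e where f: "\<forall>i<?n. \<forall>j<?n. ?A $$ (i, j) = (\<Sum>k<?n. e k * f k i * f k j)"
    "\<forall>k<?n. \<forall>l<?n. (\<Sum>i<?n. f k i * f l i) = of_bool (k = l)"
    "\<forall>i<?n. \<forall>j<?n. (\<Sum>k<?n. f k i * f k j) = of_bool (i = j)"
    "proots (char_poly ?A) = image_mset e (mset_set {..<?n})"
    by (rule real_spectral_proots[OF A sym])
  have bij: "bij_betw ((!) vs) {..<?n} V" using bij_betw_nth[OF vs(1)] vs(2) by blast
  define idx where "idx = the_inv_into {..<?n} ((!) vs)"
  have idx: "idx u < ?n" "vs ! idx u = u" if "u \<in> V" for u
    using bij_betwE[OF bij_betw_the_inv_into[OF bij]] f_the_inv_into_f_bij_betw[OF bij] that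
    by (auto simp: idx_def)
  have idx_nth: "idx (vs ! i) = i" if "i < ?n" for i
    using that bij by (simp add: idx_def the_inv_into_f_f bij_betw_def)
  have "spectral_decomposition V D ?n e (\<lambda>k u. f k (idx u))"
  proof
    show "finite V" by (rule pair_finite_verts)
    show "D u v = (\<Sum>k<?n. e k * f k (idx u) * f k (idx v))" if "u \<in> V" "v \<in> V" for u v
      using entry[of "idx u" "idx v"] f(1)[rule_format, of "idx u" "idx v"] idx that by simp
    show "(\<Sum>u\<in>V. f k (idx u) * f l (idx u)) = of_bool (k = l)" if "k < ?n" "l < ?n" for k l
    proof -
      have "(\<Sum>u\<in>V. f k (idx u) * f l (idx u)) = (\<Sum>i<?n. f k (idx (vs ! i)) * f l (idx (vs ! i)))"
        by (rule sum.reindex_bij_betw[OF bij, symmetric])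
      also have "\<dots> = (\<Sum>i<?n. f k i * f l i)" by (simp add: idx_nth)
      finally show ?thesis using f(2) that by simp
    qed
    show "(\<Sum>k<?n. f k (idx u) * f k (idx v)) = of_bool (u = v)" if "u \<in> V" "v \<in> V" for u v
    proof -
      have "idx u = idx v \<longleftrightarrow> u = v" using idx that by metis
      then show ?thesis using f(3)[rule_format, of "idx u" "idx v"] idx that by simp
    qed
  qed
  then show ?thesis using that f(4) unfolding distance_eigenvalues_def by blast
qed

lemma size_exceptional:
  assumes "spectral_decomposition V D n e F" "ev = image_mset e (mset_set {..<n})"
  shows "size {#x \<in># ev. x \<noteq> -1 \<and> x \<noteq> -3#} = card (spectral_decomposition.exc n e)"
proof -
  interpret spectral_decomposition V D n e F by fact
  have "exc = {k \<in> {..<n}. e k \<noteq> -1 \<and> e k \<noteq> -3}" by (auto simp: exc_def)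
  then show ?thesis by (simp add: assms(2) filter_mset_image_mset)
qed

end

section \<open>Graphs with exactly two exceptional eigenvalues\<close>

locale two_exceptional_graph = connected_pair_graph G + spectral_decomposition V D n e F
  for G :: "'a pair_pre_digraph" and n e F +
  assumes card_exc: "card exc = 2"
begin

lemma D_self: "u \<in> V \<Longrightarrow> D u u = 0"
  using dist_0_iff by (simp add: D_def)

lemma D_sym: "u \<in> V \<Longrightarrow> v \<in> V \<Longrightarrow> D u v = D v u"
  using dist_sym by (simp add: D_def)

lemma D_edge: "(u, v) \<in> E \<Longrightarrow> D u v = 1"
  using dist_1_iff[of u v] wellformed'[of u v] by (simp add: D_def)

text \<open>In a complete graph all entries of \<open>M\<close> are equal, and there is at most one
  exceptional eigenvalue.\<close>

lemma nonadjacent_exists: "\<exists>u\<in>V. \<exists>v\<in>V. d u v \<ge> 2"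
proof (rule ccontr)
  assume no: "\<not> ?thesis"
  have "D u v = of_bool (u \<noteq> v)" if "u \<in> V" "v \<in> V" for u v
  proof -
    have "d u v = 0 \<or> d u v = 1" using no that by fastforce
    then show ?thesis using dist_0_iff[OF that] by (auto simp: D_def)
  qed
  \<comment> \<open>A complete graph is the degenerate case in which \<open>H\<close> is empty and
    all vertices lie on one side.\<close>
  then interpret complete: two_multipartite_spectral V "\<lambda>_ _. False" "\<lambda>_. True" D n e F
    by unfold_locales (simp_all add: finV)
  have "M u v = (real (card V) + 2) * 1" if "u \<in> V" "v \<in> V" for u v
  proof -
    have "complete.part u = complete.side u" "v \<in> complete.part u"
      using that by (auto simp: complete.part_def complete.side_def)
    then show ?thesis using complete.M_part[OF that(1)] by simp
  qed
  then have "card exc \<le> 1" by (rule card_exc_le_1)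
  then show False using card_exc by simp
qed

lemma two_exceptional_ex: "\<exists>k1 k2. two_exceptional V D n e F k1 k2"
proof -
  obtain u v where uv: "u \<in> V" "v \<in> V" "d u v \<ge> 2" using nonadjacent_exists by blast
  obtain w where w: "w \<in> V" "d u w = 2" using dist_attained[OF uv] by blast
  obtain x where x: "x \<in> V" "(x, w) \<in> E" "d u x = 1" using dist_Suc[OF uv(1) w(1), of 1] w(2) by auto
  have "D u x = 1" "D u w = 2" "D x w = 1" using x w D_edge by (simp_all add: D_def)
  moreover have "u \<noteq> x" "u \<noteq> w" "x \<noteq> w"
    using x(3) w(2) dist_0_iff[OF uv(1) x(1)] dist_0_iff[OF uv(1) w(1)] pair_no_loops[OF x(2)] by auto
  ultimately show ?thesis
    using D_self D_sym uv(1) x(1) w(1) by (intro two_exceptionalI[OF card_exc uv(1) x(1) w(1)]) auto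
qed

text \<open>On a shortest path of length 3, the weights 2, 1, -1, -2 give the form of
  \<open>D + 3 I\<close> the value -4, against \<open>form3_nonneg\<close>.\<close>

lemma diameter_le_2:
  assumes "u \<in> V" "v \<in> V"
  shows "d u v \<le> 2"
proof (rule ccontr)
  assume "\<not> d u v \<le> 2"
  then have "3 \<le> d u v" by simp
  obtain k1 k2 where "two_exceptional V D n e F k1 k2" using two_exceptional_ex by blast
  then interpret two_exceptional V D n e F k1 k2 .
  obtain z where z: "z \<in> V" "d u z = 3" using dist_attained[OF assms \<open>3 \<le> d u v\<close>] by blast
  have "d u z = Suc 2" using z by simp
  then obtain y where y: "y \<in> V" "(y, z) \<in> E" "d u y = 2" by (rule dist_Suc[OF assms(1) z(1)])
  have "d u y = Suc 1" using y by simp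
  then obtain x where x: "x \<in> V" "(x, y) \<in> E" "d u x = 1" by (rule dist_Suc[OF assms(1) y(1)])
  have ux: "(u, x) \<in> E" using dist_1_iff[OF assms(1) x(1)] x(3) by simp
  have "d x z = 2"
  proof -
    have "d x z \<le> 2" using dist_le_2[OF x(1,2) y(2)] .
    moreover have "d x z \<noteq> 1"
      using dist_1_iff[OF x(1) z(1)] dist_le_2[OF assms(1) ux, of z] z(2) by auto
    moreover have "d x z \<noteq> 0" using dist_0_iff[OF x(1) z(1)] x(3) z(2) by auto
    ultimately show ?thesis by linarith
  qed
  then have D: "D u x = 1" "D u y = 2" "D u z = 3" "D x y = 1" "D x z = 2" "D y z = 1"
    using x y z D_edge by (simp_all add: D_def)
  have D': "D x u = 1" "D y u = 2" "D z u = 3" "D y x = 1" "D z x = 2" "D z y = 1"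
    using D D_sym assms(1) x(1) y(1) z(1) by metis+
  have D0: "D u u = 0" "D x x = 0" "D y y = 0" "D z z = 0"
    using D_self assms(1) x(1) y(1) z(1) by blast+
  define K where "K = (\<lambda>a b. D a b + 3 * of_bool (a = b))"
  have K: "K a b = D a b" if "D a b \<noteq> 0" "a \<in> V" for a b
    using that D_self by (auto simp: K_def)
  have Kval: "K u x = 1" "K u y = 2" "K u z = 3" "K x y = 1" "K x z = 2" "K y z = 1"
    "K x u = 1" "K y u = 2" "K z u = 3" "K y x = 1" "K z x = 2" "K z y = 1"
    using K D D' assms(1) x(1) y(1) z(1) by simp_all
  have K0: "K u u = 3" "K x x = 3" "K y y = 3" "K z z = 3" using D0 by (simp_all add: K_def)
  let ?p = "(!) [u, x, y, z]" and ?a = "(!) [2, 1, -1, -2 :: real]"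
  have pts: "?p i \<in> V" if "i < 4" for i
    using that assms(1) x(1) y(1) z(1) by (auto simp: eval_nat_numeral less_Suc_eq)
  have "0 \<le> form V K (\<lambda>w. \<Sum>i<4. ?a i * of_bool (w = ?p i))"
    unfolding K_def by (rule form3_nonneg)
  also have "\<dots> = (\<Sum>i<4. \<Sum>j<4. ?a i * ?a j * K (?p i) (?p j))"
    by (rule form_points[OF finV pts])
  also have "\<dots> = - 4"
  proof -
    have "(\<Sum>i<4. f i) = f 0 + f 1 + f 2 + f 3" for f :: "nat \<Rightarrow> real"
      by (simp add: eval_nat_numeral lessThan_Suc)
    then show ?thesis by (simp add: Kval K0)
  qed
  finally show False by simp
qed

lemma co_iso_classification:
  "(\<exists>m\<ge>1. co_iso H V (graph_join (graph_union (complete_graph 5) (complete_graph 1))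
      (graph_copies m (complete_graph 2))))
    \<or> (\<exists>r\<ge>1. \<exists>m\<ge>2. co_iso H V (graph_join (complete_graph r) (graph_copies m (complete_graph 2))))
    \<or> (\<exists>m1\<ge>2. \<exists>m2\<ge>2. co_iso H V (graph_join (graph_copies m1 (complete_graph 2))
      (graph_copies m2 (complete_graph 2))))"
proof -
  obtain k1 k2 where "two_exceptional V D n e F k1 k2" using two_exceptional_ex by blast
  then interpret two_exceptional V D n e F k1 k2 .
  \<comment> \<open>The ends of a nonedge of \<open>G\<close> are at distance 2; the middle vertex
    of a shortest path is adjacent in \<open>H\<close> to neither.\<close>
  have common: "\<exists>w\<in>V. \<not> H u w \<and> \<not> H v w" if uv: "H u v" for u v
  proof -
    have V: "u \<in> V" "v \<in> V" "u \<noteq> v" "(u, v) \<notin> E" using uv by (auto simp: H_def)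
    have "d u v \<noteq> 0" "d u v \<noteq> 1" "d u v \<le> 2"
      using V dist_0_iff[OF V(1,2)] dist_1_iff[OF V(1,2)] diameter_le_2[OF V(1,2)] by auto
    then have "d u v = Suc 1" by linarith
    then obtain w where w: "w \<in> V" "(w, v) \<in> E" "d u w = 1" by (rule dist_Suc[OF V(1,2)])
    then have "(u, w) \<in> E" using dist_1_iff[OF V(1) w(1)] by simp
    moreover have "(v, w) \<in> E" using symD[OF sym_E w(2)] .
    ultimately show ?thesis using w(1) by (auto simp: H_def)
  qed
  interpret diameter_two_extremal V D n e F k1 k2 H
    using H_basic D_H_if_diameter_2[OF diameter_le_2] common by unfold_locales blast+
  obtain u v where uv: "u \<in> V" "v \<in> V" "d u v \<ge> 2" using nonadjacent_exists by blast
  then have "H u v"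
    using dist_0_iff[OF uv(1,2)] dist_1_iff[OF uv(1,2)] by (auto simp: H_def)
  then obtain S where S: "two_multipartite V H S" "S u" "\<exists>y\<in>V. \<not> S y"
    by (rule two_multipartite_if_edge)
  then obtain y where y: "y \<in> V" "\<not> S y" by blast
  interpret two_multipartite V H S by fact
  interpret extremal_sides V H S D n e F k1 k2
    using D_H by unfold_locales
  show ?thesis using classification[OF \<open>H u v\<close> y(1)] y(2) S(2) by blast
qed

end

theorem theorem4p2:
  fixes G :: "'a pair_pre_digraph" and vs :: "'a list"
  assumes "pair_graph G"
    and "Digraph_Component.connected (with_proj G)"
    and "distinct vs" and "set vs = pverts G"
  shows "size {#x \<in># distance_eigenvalues G vs. x \<noteq> -1 \<and> x \<noteq> -3#} = 2 \<longleftrightarrow>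
    (\<exists>m\<ge>1. digraph_iso (with_proj G)
        (with_proj (graph_join (graph_union (complete_graph 5) (complete_graph 1))
                               (graph_copies m (complete_graph 2)))))
    \<or> (\<exists>r\<ge>1. \<exists>m\<ge>2. digraph_iso (with_proj G)
        (with_proj (graph_join (complete_graph r) (graph_copies m (complete_graph 2)))))
    \<or> (\<exists>m1\<ge>2. \<exists>m2\<ge>2. digraph_iso (with_proj G)
        (with_proj (graph_join (graph_copies m1 (complete_graph 2))
                               (graph_copies m2 (complete_graph 2)))))"
proof -
  interpret connected_pair_graph G
    using assms(1,2) by (simp add: connected_pair_graph_def connected_pair_graph_axioms_def)
  have iso: "digraph_iso (with_proj G) (with_proj K) \<longleftrightarrow> co_iso H V K" if "pair_graph K" for K :: "'b pair_pre_digraph"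
    using that co_iso_if_digraph_iso digraph_iso_if_co_iso by blast
  note pg = pair_graph_graph_join pair_graph_graph_union pair_graph_graph_copies pair_graph_complete_graph
  obtain e F where sd: "spectral_decomposition V D (length vs) e F"
    and ev: "distance_eigenvalues G vs = image_mset e (mset_set {..<length vs})"
    by (rule D_spectral[OF assms(3,4)])
  interpret spectral_decomposition V D "length vs" e F by (rule sd)
  have "card exc = 2 \<longleftrightarrow>
    (\<exists>m\<ge>1. co_iso H V (graph_join (graph_union (complete_graph 5) (complete_graph 1))
      (graph_copies m (complete_graph 2))))
    \<or> (\<exists>r\<ge>1. \<exists>m\<ge>2. co_iso H V (graph_join (complete_graph r) (graph_copies m (complete_graph 2))))
    \<or> (\<exists>m1\<ge>2. \<exists>m2\<ge>2. co_iso H V (graph_join (graph_copies m1 (complete_graph 2))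
      (graph_copies m2 (complete_graph 2))))" (is "_ \<longleftrightarrow> ?R")
  proof
    assume "card exc = 2"
    then interpret two_exceptional_graph G "length vs" e F by unfold_locales
    show ?R by (rule co_iso_classification)
  next
    assume ?R
    moreover have "\<forall>u v. H u v \<longrightarrow> u \<in> V" "\<forall>u. \<not> H u u" "\<forall>u v. H u v \<longrightarrow> H v u"
      using H_basic by blast+
    ultimately obtain S where S: "two_multipartite V H S" "two_multipartite.extremal V H S"
      using extremal_if_co_iso[OF finV] by blast
    interpret two_multipartite V H S by (rule S(1))
    obtain x y where xy: "x \<in> V" "y \<in> V" "S x \<noteq> S y" using S(2) unfolding extremal_def by blast
    \<comment> \<open>Vertices adjacent in \<open>H\<close> lie on the same side, and every vertex
      of the other side is their common neighbour in \<open>G\<close>.\<close>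
    have "d u v \<le> 2" if uv: "u \<in> V" "v \<in> V" for u v
    proof (cases "u = v \<or> (u, v) \<in> E")
      case True
      then show ?thesis using dist_0_iff[OF uv] dist_1_iff[OF uv] by auto
    next
      case False
      then have "H u v" using uv by (simp add: H_def)
      then have "S u = S v" by (rule H_side)
      then obtain w where w: "w \<in> V" "S w \<noteq> S u" "S w \<noteq> S v" using xy by metis
      then have "\<not> H u w" "\<not> H w v" using H_side by blast+
      then have "(u, w) \<in> E" "(w, v) \<in> E" using w uv by (auto simp: H_def)
      then show ?thesis using dist_le_2[OF uv(1)] by blast
    qed
    then interpret two_multipartite_spectral V H S D "length vs" e F
      using D_H_if_diameter_2 by unfold_locales blast
    show "card exc = 2" using S(2) by (rule extremal_card_exc)
  qed
  then show ?thesis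
    unfolding size_exceptional[OF sd ev] by (simp add: iso pg)
qed

end
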